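(* Let $\mu_1,\mu_2,c>0$, let $g(\pi)=\pi_1\wedge(1-\pi_1)+\pi_2\wedge(1-\pi_2)$ for $\pi=(\pi_1,\pi_2)\in[0,1]^2$, let $$V(\pi)=\inf_\tau\mathbb E_\pi\left[g(\Pi_\tau)+c\tau\right],$$ and let $\mathcal D=\{\pi\in[0,1]^2:V(\pi)=g(\pi)\}$ be the stopping region. Let $R_1=[0,1/2]\times[0,1/2]$, and for $i=1,2$ let $(A_i^*,1-A_i^* )$ be the continuation region of the one-dimensional sequential testing problem $ST(\mu_i,c)$. Then there exists a non-increasing upper semi-continuous function $b:[0,A_1^*]\to[0,A_2^*]$ such that $$\mathcal D\cap R_1=\{\pi\in R_1:\pi_1\le A_1^*,\ \pi_2\le b(\pi_1)\}.$$
   Context: Set-up (two-dimensional sequential testing). For $\pi\in[0,1]^2$, under $\mathbb P_\pi$ (expectation $\mathbb E_\pi$) the random variables $Y^1,Y^2$ take values in $\{0,1\}$ with $\mathbb P_\pi(Y^i=1)=\pi_i$, $W^1,W^2$ are standard Brownian motions, and $Y^1,Y^2,W^1,W^2$ are independent. One observes $X=(X^1,X^2)$ with $X^i_t=\mu_iY^it+W^i_t$, and $\mathcal F^X$ is the filtration generated by $X$. The posterior process $\Pi=(\Pi^1,\Pi^2)$ is $\Pi^i_t=\mathbb E_\pi[Y^i\mid\mathcal F^X_t]$ (continuous version); it satisfies $\Pi_0=\pi$ and $d\Pi^i_t=\mu_i\Pi^i_t(1-\Pi^i_t)\,d\bar W^i_t$, where $\bar W^i_t=X^i_t-\mu_i\int_0^t\Pi^i_s\,ds$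 and $(\bar W^1,\bar W^2)$ is a two-dimensional standard Brownian motion. The infimum in $V$ is over ($\mathbb P_\pi$-a.s. finite) $\mathcal F^X$-stopping times. Since $V\le g$, the stopping region $\mathcal D$ is the complement in $[0,1]^2$ of the continuation region $\mathcal C=\{V<g\}$. One-dimensional problem $ST(\mu,c)$, for $\mu,c>0$: with $\Pi$ the one-dimensional posterior process defined in the same way from a single observation $X_t=\mu Yt+W_t$ with $\mathbb P_\pi(Y=1)=\pi\in[0,1]$ (so $d\Pi_t=\mu\Pi_t(1-\Pi_t)\,d\bar W_t$, $\Pi_0=\pi$), set $u^{\mu,c}(\pi)=\inf_\tau\mathbb E_\pi[\Pi_\tau\wedge(1-\Pi_\tau)+c\tau]$. It is known that $u^{\mu,c}$ is concave and that its continuation region $\{\pi\in[0,1]:u^{\mu,c}(\pi)<\pi\wedge(1-\pi)\}$ is of the form $(A^*,1-A^* )$ for some $A^*\in(0,1/2)$; $A_i^*$ denotes this $A^*$ for $ST(\mu_i,c)$. *)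

theory Defs
  imports "HOL-Probability.Probability"
begin

text \<open>Paths are only considered on the time set \<open>[0, \<infinity>)\<close>; values at negative times are irrelevant.\<close>

definition standard_brownian_motion :: "'w measure \<Rightarrow> (real \<Rightarrow> 'w \<Rightarrow> real) \<Rightarrow> bool" where
  "standard_brownian_motion M B \<longleftrightarrow>
     (\<forall>t\<ge>0. B t \<in> borel_measurable M) \<and>
     (AE \<omega> in M. B 0 \<omega> = 0) \<and>
     (\<forall>\<omega>\<in>space M. continuous_on {0..} (\<lambda>t. B t \<omega>)) \<and>
     (\<forall>s t. 0 \<le> s \<and> s < t \<longrightarrow>
        distributed M lborel (\<lambda>\<omega>. B t \<omega> - B s \<omega>) (normal_density 0 (sqrt (t - s)))) \<and>
     (\<forall>(n::nat) (t::nat \<Rightarrow> real). 0 \<le> t 0 \<and> (\<forall>k<n. t k < t (Suc k)) \<longrightarrow>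
        prob_space.indep_vars M (\<lambda>_. borel) (\<lambda>k \<omega>. B (t (Suc k)) \<omega> - B (t k) \<omega>) {..<n})"

text \<open>
  The (raw) filtration generated by a finite family of processes. It is indexed by \<open>ennreal\<close>, i.e.
  by \<open>[0, \<infinity>]\<close>, so that the library notion \<^const>\<open>stopping_time\<close> describes extended-valued
  stopping times; at \<open>t = \<infinity>\<close> its condition holds trivially.
\<close>

definition generated_filtration ::
    "'w set \<Rightarrow> ('i \<Rightarrow> real \<Rightarrow> 'w \<Rightarrow> real) \<Rightarrow> ennreal \<Rightarrow> 'w measure" where
  "generated_filtration \<Omega> X t =
     sigma \<Omega> {X i s -` B \<inter> \<Omega> | i s B. 0 \<le> s \<and> ennreal s \<le> t \<and> B \<in> sets borel}"

definition upper_semicontinuous_on :: "'a::topological_space set \<Rightarrow> ('a \<Rightarrow> real) \<Rightarrow> bool" where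
  "upper_semicontinuous_on S f \<longleftrightarrow>
     (\<forall>x\<in>S. \<forall>a>f x. eventually (\<lambda>y. f y < a) (at x within S))"

text \<open>
  The sequential testing set-up with one observation channel for each element of the finite index
  type \<open>'n\<close>; the one- and two-dimensional problems are the instances \<open>'n = 1\<close> and \<open>'n = 2\<close>.
  The measurable space \<open>M\<close> and the variables \<open>Y\<close>, \<open>W\<close> are common to all priors
  \<open>\<pi> \<in> [0,1]\<^sup>n\<close>; only the probability \<open>P \<pi>\<close> and the posterior process \<open>Post \<pi>\<close> depend on \<open>\<pi>\<close>.
  (The measure carried by \<open>M\<close> itself plays no role.)
\<close>

locale sequential_testing =
  fixes \<mu> :: "real ^ 'n::finite"
    and M :: "'w measure"
    and P :: "real ^ 'n \<Rightarrow> 'w measure"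
    and Y :: "'n \<Rightarrow> 'w \<Rightarrow> real"
    and W :: "'n \<Rightarrow> real \<Rightarrow> 'w \<Rightarrow> real"
    and Post :: "real ^ 'n \<Rightarrow> real \<Rightarrow> 'w \<Rightarrow> real ^ 'n"
begin

definition X :: "'n \<Rightarrow> real \<Rightarrow> 'w \<Rightarrow> real" where
  "X i t \<omega> = \<mu> $ i * Y i \<omega> * t + W i t \<omega>"

definition FX :: "ennreal \<Rightarrow> 'w measure" where
  "FX = generated_filtration (space M) X"

definition g :: "real ^ 'n \<Rightarrow> real" where
  "g \<pi> = (\<Sum>i\<in>UNIV. min (\<pi> $ i) (1 - \<pi> $ i))"

text \<open>
  The expected cost is a \<open>[0, \<infinity>]\<close>-valued integral, since \<open>\<tau>\<close> need not be integrable. For \<open>\<tau> = \<infinity>\<close>,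
  a null event for admissible \<open>\<tau>\<close>, \<^const>\<open>enn2real\<close> merely supplies a dummy time.
\<close>

definition V :: "real \<Rightarrow> real ^ 'n \<Rightarrow> ennreal" where
  "V c \<pi> = (INF \<tau> \<in> {\<tau>. stopping_time FX \<tau> \<and> (AE \<omega> in P \<pi>. \<tau> \<omega> < \<infinity>)}.
      \<integral>\<^sup>+ \<omega>. (ennreal (g (Post \<pi> (enn2real (\<tau> \<omega>)) \<omega>)) + ennreal c * \<tau> \<omega>) \<partial>P \<pi>)"

definition continuation_region :: "real \<Rightarrow> (real ^ 'n) set" where
  "continuation_region c = {\<pi> \<in> cbox 0 1. V c \<pi> < ennreal (g \<pi>)}"

definition stopping_region :: "real \<Rightarrow> (real ^ 'n) set" where
  "stopping_region c = {\<pi> \<in> cbox 0 1. V c \<pi> = ennreal (g \<pi>)}"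

end

text \<open>
  The independence assumption concerns the \<open>\<sigma>\<close>-algebras generated by the single variables \<open>Y i\<close> and
  by the whole processes \<open>W i\<close>, jointly over all \<open>i\<close>. The posterior is a version of the conditional
  expectation at every time (hence adapted) with continuous paths.
\<close>

locale sequential_testing_model = sequential_testing \<mu> M P Y W Post
  for \<mu> :: "real ^ 'n::finite"
    and M :: "'w measure"
    and P :: "real ^ 'n \<Rightarrow> 'w measure"
    and Y :: "'n \<Rightarrow> 'w \<Rightarrow> real"
    and W :: "'n \<Rightarrow> real \<Rightarrow> 'w \<Rightarrow> real"
    and Post :: "real ^ 'n \<Rightarrow> real \<Rightarrow> 'w \<Rightarrow> real ^ 'n" +
  assumes prob_space_P: "\<And>\<pi>. \<pi> \<in> cbox 0 1 \<Longrightarrow> prob_space (P \<pi>)"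
    and sets_P: "\<And>\<pi>. \<pi> \<in> cbox 0 1 \<Longrightarrow> sets (P \<pi>) = sets M"
    and Y_measurable: "\<And>i. Y i \<in> borel_measurable M"
    and Y_values: "\<And>i \<omega>. \<omega> \<in> space M \<Longrightarrow> Y i \<omega> \<in> {0, 1}"
    and Y_prob: "\<And>\<pi> i. \<pi> \<in> cbox 0 1 \<Longrightarrow> measure (P \<pi>) {\<omega> \<in> space M. Y i \<omega> = 1} = \<pi> $ i"
    and W_brownian: "\<And>\<pi> i. \<pi> \<in> cbox 0 1 \<Longrightarrow> standard_brownian_motion (P \<pi>) (W i)"
    and independent: "\<And>\<pi>. \<pi> \<in> cbox 0 1 \<Longrightarrow> prob_space.indep_sets (P \<pi>)
      (case_sum
        (\<lambda>i. {Y i -` B \<inter> space M | B. B \<in> sets borel})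
        (\<lambda>i. sigma_sets (space M) {W i t -` B \<inter> space M | t B. 0 \<le> t \<and> B \<in> sets borel}))
      (UNIV :: ('n + 'n) set)"
    and Post_adapted: "\<And>\<pi> i t. \<pi> \<in> cbox 0 1 \<Longrightarrow> 0 \<le> t \<Longrightarrow>
      (\<lambda>\<omega>. Post \<pi> t \<omega> $ i) \<in> borel_measurable (FX (ennreal t))"
    and Post_cond_exp: "\<And>\<pi> i t. \<pi> \<in> cbox 0 1 \<Longrightarrow> 0 \<le> t \<Longrightarrow>
      AE \<omega> in P \<pi>. Post \<pi> t \<omega> $ i = real_cond_exp (P \<pi>) (FX (ennreal t)) (Y i) \<omega>"
    and Post_continuous: "\<And>\<pi> \<omega>. \<pi> \<in> cbox 0 1 \<Longrightarrow> \<omega> \<in> space M \<Longrightarrow>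
      continuous_on {0..} (\<lambda>t. Post \<pi> t \<omega>)"

end

theory Submission
  imports Defs
begin

text \<open>
  Given \<open>Y = y\<close>, the observation is a Brownian path with a drift, so its law does not depend on the
  prior \<open>\<pi>\<close>. Writing the terminal cost \<open>g\<close> as the smallest conditional error of a decision about
  \<open>Y\<close>, and replacing stopping times by finite-valued ones, \<open>V\<close> becomes an infimum of functions that are
  affine in each coordinate of \<open>\<pi>\<close>. Hence \<open>V\<close> is upper semicontinuous and concave in each coordinate.
  Using a one-dimensional rule in the plane gives \<open>V < g\<close> as soon as \<open>\<pi>\<^sub>i > A\<^sub>i\<close>. On the edge
  \<open>\<pi>\<^sub>j = 0\<close> the channel \<open>j\<close> carries only noise, so \<open>V\<close> is there the one-dimensional value, which equals
  \<open>g\<close> for \<open>\<pi>\<^sub>i \<le> A\<^sub>i\<close>. Since \<open>g\<close> is affine on \<open>R\<^sub>1\<close>, concavity propagates \<open>V = g\<close> from a point and its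
  projection to an edge to the segment between them. So the stopping region in \<open>R\<^sub>1\<close> is closed and
  downward closed, and \<open>b\<close> is the upper end of its vertical sections.
\<close>

section \<open>The law of a Brownian path\<close>

text \<open>The three testing problems live on unrelated probability spaces, and the posterior
  process changes with the prior, so quantities built from \<open>Post\<close> cannot be compared
  directly between priors or models. What can be transported is a rule that is a function of the
  observed path alone: its risk given the hypotheses is a number attached to the noise law and the
  drifts. The prior then enters only through a product with one affine factor per coordinate. The
  posterior is specified by conditional expectations at fixed times. Rules are therefore restricted
  to finitely many stopping values: a stopped posterior can be averaged on each event of stopping at
  \<open>t\<close> separately, and all risks are finite. Refining a grid shows that nothing is lost,
  by continuity of the posterior paths and boundedness of \<open>g\<close>. The infimum in
  \<open>V\<close> need not be attained, so the geometric argument never handles \<open>V\<close>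
  itself: \<open>V < g\<close> means that some rule beats \<open>g\<close>, and \<open>V = g\<close>
  that none does. Concavity and semicontinuity thus become statements about one affine function at a
  time.\<close>

definition path_space :: "(real \<Rightarrow> real) measure" where
  "path_space = sigma UNIV {(\<lambda>x. x s) -` B | s B. 0 \<le> s \<and> B \<in> sets borel}"

lemma space_path_space [simp]: "space path_space = UNIV"
  by (simp add: path_space_def space_measure_of_conv)

lemma sets_path_space:
  "sets path_space = sigma_sets UNIV {(\<lambda>x. x s) -` B | s B. 0 \<le> s \<and> B \<in> sets borel}"
  by (simp add: path_space_def)

text \<open>Only evaluations at nonnegative times generate the sigma-algebra, so a process about
  which nothing is known before time 0 is still a measurable map into
  \<open>path_space\<close>.\<close>

lemma measurable_path_spaceI:
  fixes f :: "_ \<Rightarrow> real \<Rightarrow> real"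
  assumes "\<And>s. 0 \<le> s \<Longrightarrow> (\<lambda>\<omega>. f \<omega> s) \<in> borel_measurable A"
  shows "f \<in> A \<rightarrow>\<^sub>M path_space"
  unfolding path_space_def
proof (rule measurable_measure_of)
  fix C :: "(real \<Rightarrow> real) set"
  assume "C \<in> {(\<lambda>x. x s) -` B | s B. 0 \<le> s \<and> B \<in> sets (borel :: real measure)}"
  then obtain s B where C: "C = (\<lambda>x. x s) -` B" and "0 \<le> s" "B \<in> sets borel" by blast
  then have "(\<lambda>\<omega>. f \<omega> s) -` B \<inter> space A \<in> sets A"
    using assms measurable_sets by blast
  then show "f -` C \<inter> space A \<in> sets A" by (simp add: C vimage_def)
qed auto

lemma measurable_path_space_eval [measurable]:
  assumes "0 \<le> s" shows "(\<lambda>x. x s) \<in> borel_measurable path_space"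
  by (rule measurableI) (use assms in \<open>auto simp: sets_path_space intro!: sigma_sets.Basic\<close>)

lemma brownian_path_measurable:
  assumes "standard_brownian_motion M B"
  shows "(\<lambda>\<omega> s. B s \<omega>) \<in> M \<rightarrow>\<^sub>M path_space"
  using assms by (intro measurable_path_spaceI) (auto simp: standard_brownian_motion_def)

text \<open>In terms of increments the event concerns independent centred Gaussians: almost surely
  \<open>B (t k)\<close> is the sum of the first \<open>k\<close> increments, since
  \<open>t 0 = 0\<close> and \<open>B 0 = 0\<close>. The right-hand side mentions neither
  \<open>M\<close> nor \<open>B\<close>, and uniqueness of the law rests on this.\<close>

lemma brownian_finite_dimensional:
  fixes t :: "nat \<Rightarrow> real"
  assumes "prob_space M" and bm: "standard_brownian_motion M B"
    and t0: "t 0 = 0" and t: "\<And>k. k < n \<Longrightarrow> t k < t (Suc k)" and "0 < n"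
    and C: "\<And>k. k \<le> n \<Longrightarrow> C k \<in> sets borel"
  shows "emeasure M {\<omega> \<in> space M. \<forall>k\<le>n. B (t k) \<omega> \<in> C k} =
    emeasure (PiM {..<n} (\<lambda>k. density lborel (normal_density 0 (sqrt (t (Suc k) - t k)))))
      {z \<in> space (PiM {..<n} (\<lambda>_. borel)). \<forall>k\<le>n. (\<Sum>j<k. z j) \<in> C k}"
    (is "emeasure M ?E = emeasure (PiM _ ?N) ?K")
proof -
  interpret prob_space M by fact
  let ?inc = "\<lambda>k \<omega>. B (t (Suc k)) \<omega> - B (t k) \<omega>"
  have tk: "0 \<le> t k" if "k \<le> n" for k
    using that
  proof (induction k)
    case (Suc k)
    then show ?case using t[of k] by simp
  qed (simp add: t0)
  have Bm: "B s \<in> borel_measurable M" if "0 \<le> s" for s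
    using bm that by (auto simp: standard_brownian_motion_def)
  have incm: "?inc k \<in> borel_measurable M" if "k \<in> {..<n}" for k
    using that tk[of k] tk[of "Suc k"] by (intro borel_measurable_diff Bm) auto
  have "indep_vars (\<lambda>_. borel) ?inc {..<n}"
    using bm t t0 by (auto simp: standard_brownian_motion_def)
  \<comment> \<open>The product form of independence is stated for a non-empty index set, hence
    \<open>0 < n\<close>.\<close>
  then have "distr M (PiM {..<n} (\<lambda>_. borel)) (\<lambda>\<omega>. \<lambda>k\<in>{..<n}. ?inc k \<omega>)
      = PiM {..<n} (\<lambda>k. distr M borel (?inc k))"
    using \<open>0 < n\<close> incm by (subst (asm) indep_vars_iff_distr_eq_PiM') auto
  also have "\<dots> = PiM {..<n} ?N"
  proof (rule PiM_cong[OF refl])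
    fix k assume "k \<in> {..<n}"
    then have "distributed M lborel (?inc k) (normal_density 0 (sqrt (t (Suc k) - t k)))"
      using bm t[of k] tk[of k] by (auto simp: standard_brownian_motion_def)
    then show "distr M borel (?inc k) = ?N k"
      by (simp add: distributed_def cong: distr_cong)
  qed
  finally have law: "distr M (PiM {..<n} (\<lambda>_. borel)) (\<lambda>\<omega>. \<lambda>k\<in>{..<n}. ?inc k \<omega>) = PiM {..<n} ?N" .
  have K: "?K \<in> sets (PiM {..<n} (\<lambda>_. borel))"
  proof -
    have "?K = (\<Inter>k\<in>{..n}. (\<lambda>z. \<Sum>j<k. z j) -` C k \<inter> space (PiM {..<n} (\<lambda>_. borel)))"
      by auto
    also have "\<dots> \<in> sets (PiM {..<n} (\<lambda>_. borel))"
      by (intro sets.finite_INT measurable_sets[OF _ C] borel_measurable_sum) auto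
    finally show ?thesis .
  qed
  have m: "(\<lambda>\<omega>. \<lambda>k\<in>{..<n}. ?inc k \<omega>) \<in> M \<rightarrow>\<^sub>M PiM {..<n} (\<lambda>_. borel)"
    by (intro measurable_restrict incm)
  have E: "?E \<in> sets M"
  proof -
    have "?E = (\<Inter>k\<in>{..n}. B (t k) -` C k \<inter> space M)" by auto
    also have "\<dots> \<in> sets M"
      by (intro sets.finite_INT measurable_sets[OF _ C] Bm) (auto simp: tk)
    finally show ?thesis .
  qed
  \<comment> \<open>The two events agree only off the null set where \<open>B 0\<close> differs from
    0.\<close>
  have "AE \<omega> in M. B 0 \<omega> = 0" using bm by (simp add: standard_brownian_motion_def)
  then have "emeasure M ?E = emeasure M ((\<lambda>\<omega>. \<lambda>k\<in>{..<n}. ?inc k \<omega>) -` ?K \<inter> space M)"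
  proof (intro emeasure_eq_AE E measurable_sets[OF m K], eventually_elim)
    case (elim \<omega>)
    have "(\<Sum>j<k. if j < n then ?inc j \<omega> else undefined) = B (t k) \<omega>" if "k \<le> n" for k
    proof -
      have "(\<Sum>j<k. if j < n then ?inc j \<omega> else undefined) = (\<Sum>j<k. ?inc j \<omega>)"
        using that by (intro sum.cong) auto
      then show ?thesis by (simp add: sum_lessThan_telescope[of "\<lambda>j. B (t j) \<omega>"] t0 elim)
    qed
    then show ?case using measurable_space[OF m, of \<omega>]
      by (auto simp: restrict_def)
  qed
  also have "\<dots> = emeasure (PiM {..<n} ?N) ?K"
    by (simp only: emeasure_distr[OF m K, symmetric] law)
  finally show ?thesis .
qed

text \<open>Cylinder sets over finitely many nonnegative times are stable under intersection and
  generate \<open>path_space\<close>, so laws that agree on them are equal. On a cylinder, both laws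
  are given by the same Gaussian product.\<close>

lemma brownian_path_law_unique:
  assumes M: "prob_space M" "standard_brownian_motion M B"
    and M': "prob_space M'" "standard_brownian_motion M' B'"
  shows "distr M path_space (\<lambda>\<omega> s. B s \<omega>) = distr M' path_space (\<lambda>\<omega> s. B' s \<omega>)"
proof (rule measure_eqI_generator_eq)
  define E where "E = {{x. \<forall>s\<in>J. x s \<in> C s} | J C. finite (J :: real set) \<and> J \<subseteq> {0..} \<and>
    (\<forall>s. C s \<in> sets (borel :: real measure))}"
  show "Int_stable E"
  proof (rule Int_stableI)
    fix a b assume "a \<in> E" "b \<in> E"
    then obtain J C J' C' where a: "a = {x. \<forall>s\<in>J. x s \<in> C s}" "finite J" "J \<subseteq> {0..}"
        "\<And>s. C s \<in> sets (borel :: real measure)"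
      and b: "b = {x. \<forall>s\<in>J'. x s \<in> C' s}" "finite J'" "J' \<subseteq> {0..}"
        "\<And>s. C' s \<in> sets (borel :: real measure)"
      unfolding E_def by blast
    let ?D = "\<lambda>s. (if s \<in> J then C s else UNIV) \<inter> (if s \<in> J' then C' s else UNIV)"
    have "a \<inter> b = {x. \<forall>s\<in>J \<union> J'. x s \<in> ?D s}" using a b by auto
    moreover have "\<forall>s. ?D s \<in> sets borel" using a b by auto
    moreover have "finite (J \<union> J')" "J \<union> J' \<subseteq> {0..}" using a b by auto
    ultimately show "a \<inter> b \<in> E" unfolding E_def mem_Collect_eq
      by (intro exI[of _ "J \<union> J'"] exI[of _ ?D] conjI)
  qed
  show "E \<subseteq> Pow UNIV" by simp
  have gen: "sets path_space = sigma_sets UNIV E"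
  proof (intro antisym)
    show "sets path_space \<subseteq> sigma_sets UNIV E" unfolding sets_path_space
    proof (rule sigma_sets_mono, safe)
      fix s :: real and B :: "real set" assume "0 \<le> s" "B \<in> sets borel"
      then have "(\<lambda>x. x s) -` B \<in> E" unfolding E_def mem_Collect_eq
        by (intro exI[of _ "{s}"] exI[of _ "\<lambda>_. B"]) auto
      then show "(\<lambda>x. x s) -` B \<in> sigma_sets UNIV E" by (rule sigma_sets.Basic)
    qed
    have "E \<subseteq> sets path_space"
    proof
      fix a assume "a \<in> E"
      then obtain J C where a: "a = {x. \<forall>s\<in>J. x s \<in> C s}" "finite J" "J \<subseteq> {0..}"
        "\<And>s. C s \<in> sets (borel :: real measure)" unfolding E_def by blast
      have "Measurable.pred path_space (\<lambda>x. \<forall>s\<in>J. x s \<in> C s)"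
        using a by (intro pred_intros_finite pred_sets2[OF _ measurable_path_space_eval]) auto
      then show "a \<in> sets path_space" by (simp add: a pred_def)
    qed
    then show "sigma_sets UNIV E \<subseteq> sets path_space"
      using sets.sigma_sets_subset[of E path_space] by simp
  qed
  then show "sets (distr M path_space (\<lambda>\<omega> s. B s \<omega>)) = sigma_sets UNIV E"
    "sets (distr M' path_space (\<lambda>\<omega> s. B' s \<omega>)) = sigma_sets UNIV E" by simp_all
  show "range (\<lambda>_. UNIV) \<subseteq> E" unfolding E_def by (auto intro!: exI[of _ "{}"] exI[of _ "\<lambda>_. {}"])
  have "prob_space (distr M path_space (\<lambda>\<omega> s. B s \<omega>))"
    using M by (intro prob_space.prob_space_distr brownian_path_measurable)
  then show "emeasure (distr M path_space (\<lambda>\<omega> s. B s \<omega>)) UNIV \<noteq> \<infinity>"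
    using prob_space.emeasure_space_1 by fastforce
  fix a assume aE: "a \<in> E"
  then obtain J C where a: "a = {x. \<forall>s\<in>J. x s \<in> C s}" "finite J" "J \<subseteq> {0..}"
        "\<And>s. C s \<in> sets (borel :: real measure)" unfolding E_def by blast
  \<comment> \<open>Adding the times 0 and 1 changes no cylinder, as they are constrained to
    \<open>UNIV\<close> unless they lie in \<open>J\<close>. Time 0 anchors the telescoping sum, and
    two distinct times guarantee at least one increment.\<close>
  define L where "L = sorted_list_of_set (insert 0 (insert 1 J))"
  have set_L: "set L = insert 0 (insert 1 J)" unfolding L_def
    by (rule set_sorted_list_of_set) (use a(2) in simp)
  have sL: "sorted_wrt (<) L" unfolding L_def by (rule strict_sorted_list_of_set)
  define n where "n = length L - 1"
  have "card {0, 1 :: real} \<le> card (set L)" using set_L by (intro card_mono List.finite_set) auto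
  also have "\<dots> \<le> length L" by (rule card_length)
  finally have "2 \<le> length L" by simp
  then have n: "0 < n" "length L = Suc n" by (auto simp: n_def)
  define t where "t = (\<lambda>k. L ! k)"
  have t: "t k < t (Suc k)" if "k < n" for k
    using sorted_wrt_nth_less[OF sL, of k "Suc k"] that n by (simp add: t_def)
  have "0 \<le> t 0" using set_L a(3) nth_mem[of 0 L] n by (auto simp: t_def)
  moreover obtain k where k: "k < length L" "L ! k = 0"
    using set_L by (metis in_set_conv_nth insertI1)
  moreover have "t 0 \<le> L ! k"
    using sorted_wrt_nth_less[OF sL, of 0 k] k by (cases "k = 0") (auto simp: t_def)
  ultimately have t0: "t 0 = 0" by simp
  have ran: "t ` {..n} = set L" using n by (auto simp: set_conv_nth t_def less_Suc_eq_le)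
  define D where "D k = (if t k \<in> J then C (t k) else UNIV)" for k
  have aD: "x \<in> a \<longleftrightarrow> (\<forall>k\<le>n. x (t k) \<in> D k)" for x
  proof -
    have "x \<in> a \<longleftrightarrow> (\<forall>s\<in>set L. s \<in> J \<longrightarrow> x s \<in> C s)" using a set_L by auto
    also have "\<dots> \<longleftrightarrow> (\<forall>k\<le>n. x (t k) \<in> D k)" unfolding ran[symmetric] by (auto simp: D_def)
    finally show ?thesis .
  qed
  have aS: "a \<in> sets path_space" using aE gen by blast
  have *: "emeasure (distr N path_space (\<lambda>\<omega> s. F s \<omega>)) a =
    emeasure (PiM {..<n} (\<lambda>k. density lborel (normal_density 0 (sqrt (t (Suc k) - t k)))))
      {z \<in> space (PiM {..<n} (\<lambda>_. borel)). \<forall>k\<le>n. (\<Sum>j<k. z j) \<in> D k}"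
    if "prob_space N" "standard_brownian_motion N F" for N :: "'c measure" and F
  proof -
    have "emeasure (distr N path_space (\<lambda>\<omega> s. F s \<omega>)) a
        = emeasure N {\<omega> \<in> space N. \<forall>k\<le>n. F (t k) \<omega> \<in> D k}"
      by (subst emeasure_distr[OF brownian_path_measurable[OF that(2)] aS])
         (auto simp: aD intro!: arg_cong2[where f=emeasure])
    also have "\<dots> = emeasure (PiM {..<n} (\<lambda>k. density lborel (normal_density 0 (sqrt (t (Suc k) - t k)))))
      {z \<in> space (PiM {..<n} (\<lambda>_. borel)). \<forall>k\<le>n. (\<Sum>j<k. z j) \<in> D k}"
      by (rule brownian_finite_dimensional[OF that t0 t n(1)]) (auto simp: D_def a)
    finally show ?thesis .
  qed
  show "emeasure (distr M path_space (\<lambda>\<omega> s. B s \<omega>)) a = emeasure (distr M' path_space (\<lambda>\<omega> s. B' s \<omega>)) a"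
    using *[OF M] *[OF M'] by simp
qed auto

section \<open>The canonical filtration and the joint law of hypotheses and noise\<close>

definition canonical_filtration :: "ennreal \<Rightarrow> ('i \<Rightarrow> real \<Rightarrow> real) measure" where
  "canonical_filtration = generated_filtration UNIV (\<lambda>i s x. x i s)"

lemma space_canonical_filtration [simp]: "space (canonical_filtration t) = UNIV"
  by (simp add: canonical_filtration_def generated_filtration_def space_measure_of_conv)

lemma sets_canonical_filtration:
  "sets (canonical_filtration t) = sigma_sets UNIV
     {(\<lambda>x. x i s) -` B | i s B. 0 \<le> s \<and> ennreal s \<le> t \<and> B \<in> sets borel}"
  by (simp add: canonical_filtration_def generated_filtration_def)

lemma canonical_filtration_mono:
  "s \<le> t \<Longrightarrow> sets (canonical_filtration s) \<subseteq> sets (canonical_filtration t)"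
  unfolding sets_canonical_filtration by (rule sigma_sets_mono') (blast intro: order_trans)

lemma measurable_canonical_filtrationI:
  fixes f :: "_ \<Rightarrow> 'i \<Rightarrow> real \<Rightarrow> real"
  assumes "\<And>i s. 0 \<le> s \<Longrightarrow> ennreal s \<le> t \<Longrightarrow> (\<lambda>\<omega>. f \<omega> i s) \<in> borel_measurable A"
  shows "f \<in> A \<rightarrow>\<^sub>M canonical_filtration t"
  unfolding canonical_filtration_def generated_filtration_def
proof (rule measurable_measure_of)
  fix C :: "('i \<Rightarrow> real \<Rightarrow> real) set"
  assume "C \<in> {(\<lambda>x. x i s) -` B \<inter> UNIV | i s B. 0 \<le> s \<and> ennreal s \<le> t \<and> B \<in> sets (borel :: real measure)}"
  then obtain i s B where C: "C = (\<lambda>x. x i s) -` B" and "0 \<le> s" "ennreal s \<le> t" "B \<in> sets borel"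
    by blast
  then have "(\<lambda>\<omega>. f \<omega> i s) -` B \<inter> space A \<in> sets A"
    using assms measurable_sets by blast
  then show "f -` C \<inter> space A \<in> sets A" by (simp add: C vimage_def)
qed auto

lemma canonical_filtration_eval:
  assumes "0 \<le> s" "ennreal s \<le> t"
  shows "(\<lambda>x. x i s) \<in> borel_measurable (canonical_filtration t)"
  by (rule measurableI) (use assms in \<open>auto simp: sets_canonical_filtration intro!: sigma_sets.Basic\<close>)

lemma measurable_paths_eval:
  assumes "0 \<le> s"
  shows "(\<lambda>w. w i s) \<in> borel_measurable (PiM (UNIV :: 'i set) (\<lambda>_. path_space))"
  using measurable_compose[where f="\<lambda>w. w i" and N=path_space, OF _ measurable_path_space_eval[OF assms]]
  by simp

text \<open>Rules are measurable for the canonical filtration, whereas noise laws live on a product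
  of path spaces; this inclusion of sigma-algebras lets the former be integrated against the
  latter.\<close>

lemma measurable_PiM_canonical_filtration:
  "(\<lambda>w. w) \<in> PiM UNIV (\<lambda>_::'i. path_space) \<rightarrow>\<^sub>M canonical_filtration t"
  by (intro measurable_canonical_filtrationI measurable_paths_eval)

text \<open>The probability of \<open>Y = y\<close> under the prior \<open>\<pi>\<close>, with
  \<open>True\<close> standing for the value 1. Each coordinate occurs in exactly one affine factor,
  so the weight is affine in each coordinate separately.\<close>

definition prior_weight :: "real ^ 'n::finite \<Rightarrow> ('n \<Rightarrow> bool) \<Rightarrow> real" where
  "prior_weight \<pi> y = (\<Prod>i\<in>UNIV. if y i then \<pi> $ i else 1 - \<pi> $ i)"

lemma prior_weight_nonneg: "\<pi> \<in> cbox 0 1 \<Longrightarrow> 0 \<le> prior_weight \<pi> y"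
  unfolding prior_weight_def by (intro prod_nonneg) (auto simp: mem_box_cart)

text \<open>The observation produced by the noise \<open>w\<close> when the hypotheses are
  \<open>y\<close>; it is free of the prior.\<close>

definition drift :: "real ^ 'n::finite \<Rightarrow> ('n \<Rightarrow> bool) \<Rightarrow> ('n \<Rightarrow> real \<Rightarrow> real) \<Rightarrow> 'n \<Rightarrow> real \<Rightarrow> real" where
  "drift \<mu> y w = (\<lambda>i s. \<mu> $ i * of_bool (y i) * s + w i s)"

lemma measurable_drift:
  fixes y :: "'n::finite \<Rightarrow> bool"
  shows "drift \<mu> y \<in> PiM UNIV (\<lambda>_. path_space) \<rightarrow>\<^sub>M PiM UNIV (\<lambda>_. path_space)"
proof (rule measurable_PiM_single')
  fix i :: 'n
  show "(\<lambda>w. drift \<mu> y w i) \<in> PiM UNIV (\<lambda>_. path_space) \<rightarrow>\<^sub>M path_space"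
  proof (rule measurable_path_spaceI)
    fix s :: real assume "0 \<le> s"
    then have "(\<lambda>w. w i s) \<in> borel_measurable (PiM (UNIV :: 'n set) (\<lambda>_. path_space))"
      by (rule measurable_paths_eval)
    then show "(\<lambda>w. drift \<mu> y w i s) \<in> borel_measurable (PiM UNIV (\<lambda>_. path_space))"
      unfolding drift_def by measurable
  qed
qed (auto simp: space_PiM)

section \<open>Observation events as pull-backs from canonical path space\<close>

context sequential_testing
begin

abbreviation X_path :: "'w \<Rightarrow> 'n \<Rightarrow> real \<Rightarrow> real" where
  "X_path \<omega> \<equiv> \<lambda>i s. X i s \<omega>"

abbreviation W_path :: "'w \<Rightarrow> 'n \<Rightarrow> real \<Rightarrow> real" where
  "W_path \<omega> \<equiv> \<lambda>i s. W i s \<omega>"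

abbreviation Y_true :: "'w \<Rightarrow> 'n \<Rightarrow> bool" where
  "Y_true \<omega> \<equiv> \<lambda>i. Y i \<omega> = 1"

lemma space_FX [simp]: "space (FX t) = space M"
  unfolding FX_def generated_filtration_def by (rule space_measure_of) auto

lemma sets_FX_sigma_sets: "sets (FX t) =
    sigma_sets (space M) {X i s -` B \<inter> space M | i s B. 0 \<le> s \<and> ennreal s \<le> t \<and> B \<in> sets borel}"
  unfolding FX_def generated_filtration_def by (rule sets_measure_of) auto

text \<open>Generated sigma-algebras commute with preimages, so every event known at time
  \<open>t\<close> is decided by a canonical set of paths. Through this, rules on path space and
  stopping times on \<open>M\<close> are translated into each other.\<close>

lemma sets_FX: "sets (FX t) = {X_path -` A \<inter> space M | A. A \<in> sets (canonical_filtration t)}"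
proof -
  have "{X_path -` A \<inter> space M | A. A \<in> {(\<lambda>x. x i s) -` B | i s B.
      0 \<le> s \<and> ennreal s \<le> t \<and> B \<in> sets borel}}
    = {X i s -` B \<inter> space M | i s B. 0 \<le> s \<and> ennreal s \<le> t \<and> B \<in> sets borel}" (is "?L = ?R")
  proof (intro antisym subsetI)
    fix a assume "a \<in> ?L"
    then obtain i s B where "a = X_path -` ((\<lambda>x. x i s) -` B) \<inter> space M" "0 \<le> s"
      "ennreal s \<le> t" "B \<in> sets borel" by blast
    then show "a \<in> ?R" by (intro CollectI exI[of _ i] exI[of _ s] exI[of _ B]) auto
  next
    fix a assume "a \<in> ?R"
    then obtain i s B where *: "a = X i s -` B \<inter> space M" "0 \<le> s" "ennreal s \<le> t" "B \<in> sets borel"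
      by blast
    then have "a = X_path -` ((\<lambda>x. x i s) -` B) \<inter> space M" by auto
    with * show "a \<in> ?L" by blast
  qed
  then show ?thesis
    unfolding sets_FX_sigma_sets sets_canonical_filtration
    by (subst sigma_sets_vimage_commute) auto
qed

lemma FX_mono: "s \<le> t \<Longrightarrow> sets (FX s) \<subseteq> sets (FX t)"
  unfolding sets_FX using canonical_filtration_mono by blast

end

text \<open>With \<open>\<nu>\<close> a parameter, rather than defined from one model, the
  two-dimensional and both one-dimensional models can be instantiated with literally the same noise
  law.\<close>

locale sequential_testing_law = sequential_testing_model \<mu> M P Y W Post
  for \<mu> :: "real ^ 'n::finite"
    and M :: "'w measure"
    and P :: "real ^ 'n \<Rightarrow> 'w measure"
    and Y :: "'n \<Rightarrow> 'w \<Rightarrow> real"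
    and W :: "'n \<Rightarrow> real \<Rightarrow> 'w \<Rightarrow> real"
    and Post :: "real ^ 'n \<Rightarrow> real \<Rightarrow> 'w \<Rightarrow> real ^ 'n" +
  fixes \<nu> :: "(real \<Rightarrow> real) measure"
  assumes path_law: "\<And>\<pi> i. \<pi> \<in> cbox 0 1 \<Longrightarrow> distr (P \<pi>) path_space (\<lambda>\<omega> s. W i s \<omega>) = \<nu>"
begin

abbreviation noise :: "('n \<Rightarrow> real \<Rightarrow> real) measure" where
  "noise \<equiv> PiM UNIV (\<lambda>_. \<nu>)"

lemma space_P: "\<pi> \<in> cbox 0 1 \<Longrightarrow> space (P \<pi>) = space M"
  using sets_P by (rule sets_eq_imp_space_eq)

lemma zero_in_cbox: "(0 :: real ^ 'n) \<in> cbox 0 1"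
  by (simp add: mem_box_cart)

lemma sets_law [simp, measurable_cong]: "sets \<nu> = sets path_space"
  using path_law[OF zero_in_cbox] by (metis sets_distr)

lemma sets_noise [simp, measurable_cong]: "sets noise = sets (PiM UNIV (\<lambda>_. path_space))"
  by (intro sets_PiM_cong) auto

lemma prob_space_law: "prob_space \<nu>"
proof -
  fix i :: 'n
  have "prob_space (distr (P 0) path_space (\<lambda>\<omega> s. W i s \<omega>))"
    by (intro prob_space.prob_space_distr prob_space_P brownian_path_measurable W_brownian zero_in_cbox)
  then show ?thesis by (simp add: path_law zero_in_cbox)
qed

lemma W_path_measurable:
  assumes "\<pi> \<in> cbox 0 1"
  shows "W_path \<in> P \<pi> \<rightarrow>\<^sub>M PiM UNIV (\<lambda>_. path_space)"
  by (rule measurable_PiM_single')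
     (auto simp: space_PiM intro: brownian_path_measurable[OF W_brownian[OF assms]])

lemma Y_true_measurable:
  assumes "\<pi> \<in> cbox 0 1"
  shows "Y_true \<in> P \<pi> \<rightarrow>\<^sub>M count_space UNIV"
proof (rule measurable_count_space_eq2[THEN iffD2], safe)
  show "finite (UNIV :: ('n \<Rightarrow> bool) set)" by simp
  fix y :: "'n \<Rightarrow> bool"
  have "Y_true -` {y} \<inter> space (P \<pi>) = (\<Inter>i\<in>UNIV. Y i -` (if y i then {1} else - {1}) \<inter> space (P \<pi>))"
    by (auto simp: fun_eq_iff split: if_splits)
  also have "\<dots> \<in> sets (P \<pi>)"
    by (intro sets.finite_INT)
       (auto simp only: sets_P[OF assms] space_P[OF assms] intro!: measurable_sets[OF Y_measurable],
        auto)
  finally show "Y_true -` {y} \<inter> space (P \<pi>) \<in> sets (P \<pi>)" .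
qed auto

lemma X_path_eq_drift: "\<omega> \<in> space M \<Longrightarrow> X_path \<omega> = drift \<mu> (Y_true \<omega>) (W_path \<omega>)"
  using Y_values[of \<omega>] by (force simp: drift_def X_def fun_eq_iff)

text \<open>The event is an intersection of one event from each independent family,
  \<open>Inl\<close> indexing the hypotheses and \<open>Inr\<close> the noise paths, so its
  probability is a product.\<close>

lemma emeasure_joint_rectangle:
  assumes \<pi>: "\<pi> \<in> cbox 0 1" and A: "\<And>i. A i \<in> sets path_space"
  shows "emeasure (P \<pi>) {\<omega> \<in> space M. Y_true \<omega> = y \<and> (\<forall>i. (\<lambda>s. W i s \<omega>) \<in> A i)}
     = ennreal (prior_weight \<pi> y) * (\<Prod>i\<in>UNIV. emeasure \<nu> (A i))"
proof -
  interpret prob_space "P \<pi>" by (rule prob_space_P) fact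
  let ?E = "case_sum (\<lambda>i. Y i -` (if y i then {1} else - {1}) \<inter> space M)
     (\<lambda>i. (\<lambda>\<omega> s. W i s \<omega>) -` A i \<inter> space M)"
  let ?F = "case_sum (\<lambda>i. {Y i -` B \<inter> space M | B. B \<in> sets borel})
     (\<lambda>i. sigma_sets (space M) {W i t -` B \<inter> space M | t B. 0 \<le> t \<and> B \<in> sets borel})"
  \<comment> \<open>Independence is assumed for the sigma-algebra generated by the evaluations of
    \<open>W i\<close>; measurability into \<open>path_space\<close> shows that it contains every
    event about the whole path.\<close>
  have W_gen: "(\<lambda>\<omega> s. W i s \<omega>) -` A i \<inter> space M
      \<in> sigma_sets (space M) {W i t -` B \<inter> space M | t B. 0 \<le> t \<and> B \<in> sets borel}" for i
  proof -
    let ?N = "sigma (space M) {W i t -` B \<inter> space M | t B. 0 \<le> t \<and> B \<in> sets borel}"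
    have N: "sets ?N = sigma_sets (space M) {W i t -` B \<inter> space M | t B. 0 \<le> t \<and> B \<in> sets borel}"
      "space ?N = space M"
      by (auto intro!: sets_measure_of space_measure_of)
    have "(\<lambda>\<omega> s. W i s \<omega>) \<in> ?N \<rightarrow>\<^sub>M path_space"
      by (intro measurable_path_spaceI measurableI) (auto simp: N intro!: sigma_sets.Basic)
    from measurable_sets[OF this A[of i]] show ?thesis by (simp only: N)
  qed
  have EF: "\<forall>j\<in>UNIV. ?E j \<in> ?F j"
  proof
    fix j show "?E j \<in> ?F j"
    proof (cases j)
      case (Inl i)
      then show ?thesis by (auto intro!: exI[of _ "if y i then {1} else - {1}"])
    qed (simp add: W_gen)
  qed
  have "prob (\<Inter>j\<in>UNIV. ?E j) = (\<Prod>j\<in>UNIV. prob (?E j))"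
    by (rule indep_setsD[OF independent[OF \<pi>] _ _ _ EF]) auto
  also have "\<dots> = (\<Prod>i\<in>UNIV. prob (?E (Inl i))) * (\<Prod>i\<in>UNIV. prob (?E (Inr i)))"
    by (subst UNIV_Plus_UNIV[symmetric], subst prod.Plus) auto
  also have "(\<Prod>i\<in>UNIV. prob (?E (Inl i))) = prior_weight \<pi> y"
    unfolding prior_weight_def
  proof (rule prod.cong[OF refl])
    fix i :: 'n
    have 1: "{\<omega> \<in> space M. Y i \<omega> = 1} \<in> events"
      using measurable_sets[OF Y_measurable[of i], of "{1}"] sets_P[OF \<pi>]
      by (auto simp: vimage_def Int_def conj_commute)
    have "Y i -` (- {1}) \<inter> space M = space (P \<pi>) - {\<omega> \<in> space M. Y i \<omega> = 1}"
      by (auto simp: space_P[OF \<pi>])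
    then have "prob (Y i -` (- {1}) \<inter> space M) = 1 - \<pi> $ i"
      using prob_compl[OF 1] Y_prob[OF \<pi>, of i] by simp
    moreover have "Y i -` {1} \<inter> space M = {\<omega> \<in> space M. Y i \<omega> = 1}" by auto
    ultimately show "prob (?E (Inl i)) = (if y i then \<pi> $ i else 1 - \<pi> $ i)"
      using Y_prob[OF \<pi>, of i] by simp
  qed
  also have "(\<Prod>i\<in>UNIV. prob (?E (Inr i))) = (\<Prod>i\<in>UNIV. measure \<nu> (A i))"
  proof (rule prod.cong[OF refl])
    fix i :: 'n
    show "prob (?E (Inr i)) = measure \<nu> (A i)"
      unfolding path_law[OF \<pi>, of i, symmetric]
      by (subst measure_distr[OF brownian_path_measurable[OF W_brownian[OF \<pi>]] A])
         (simp add: space_P[OF \<pi>])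
  qed
  finally have "prob (\<Inter>j\<in>UNIV. ?E j) = prior_weight \<pi> y * (\<Prod>i\<in>UNIV. measure \<nu> (A i))" .
  moreover have "(\<Inter>j\<in>UNIV. ?E j) = {\<omega> \<in> space M. Y_true \<omega> = y \<and> (\<forall>i. (\<lambda>s. W i s \<omega>) \<in> A i)}"
    unfolding UNIV_Plus_UNIV[symmetric] Plus_def
    by (auto simp: fun_eq_iff INT_Un split: if_splits)
  moreover interpret \<nu>: prob_space \<nu> by (rule prob_space_law)
  have "ennreal (prior_weight \<pi> y * (\<Prod>i\<in>UNIV. measure \<nu> (A i)))
      = ennreal (prior_weight \<pi> y) * (\<Prod>i\<in>UNIV. emeasure \<nu> (A i))"
    using prior_weight_nonneg[OF \<pi>]
    by (simp add: ennreal_mult prod_nonneg \<nu>.emeasure_eq_measure prod_ennreal)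
  ultimately show ?thesis by (simp add: emeasure_eq_measure)
qed

text \<open>Disintegration over the hypotheses: restricted to \<open>Y_true = y\<close>, the noise
  path has law \<open>noise\<close> scaled by \<open>prior_weight \<pi> y\<close>. Two finite
  measures that agree on rectangles agree, so independence on rectangles suffices.\<close>

lemma nn_integral_joint:
  assumes \<pi>: "\<pi> \<in> cbox 0 1"
    and F: "\<And>y. F y \<in> borel_measurable (PiM UNIV (\<lambda>_. path_space))"
  shows "(\<integral>\<^sup>+\<omega>. F (Y_true \<omega>) (W_path \<omega>) \<partial>P \<pi>) =
     (\<Sum>y\<in>UNIV. ennreal (prior_weight \<pi> y) * (\<integral>\<^sup>+w. F y w \<partial>noise))"
proof -
  interpret prob_space "P \<pi>" by (rule prob_space_P) fact
  interpret \<nu>: prob_space \<nu> by (rule prob_space_law)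
  interpret product_sigma_finite "\<lambda>_::'n. \<nu>" ..
  note [measurable] = W_path_measurable[OF \<pi>] Y_true_measurable[OF \<pi>] F
  \<comment> \<open>An unnormalised restriction takes the place of conditioning, because for priors
    on the boundary of the cube some hypotheses have probability zero.\<close>
  have slice: "distr (density (P \<pi>) (indicator {\<omega> \<in> space M. Y_true \<omega> = y})) noise W_path
      = density noise (\<lambda>_. ennreal (prior_weight \<pi> y))" (is "?L = ?R") for y
  proof (rule measure_eqI_PiM_finite[where I=UNIV and M="\<lambda>_::'n. \<nu>"])
    have Ey: "{\<omega> \<in> space M. Y_true \<omega> = y} \<in> sets (P \<pi>)"
    proof -
      have "Measurable.pred (P \<pi>) (\<lambda>\<omega>. Y_true \<omega> = y)" by measurable
      then show ?thesis by (simp add: pred_def space_P[OF \<pi>])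
    qed
    have rect: "emeasure ?L (Pi\<^sub>E UNIV A) = ennreal (prior_weight \<pi> y) * (\<Prod>i\<in>UNIV. emeasure \<nu> (A i))"
      if A: "\<And>i. A i \<in> sets path_space" for A
    proof -
      have AP: "Pi\<^sub>E UNIV A \<in> sets (PiM UNIV (\<lambda>_::'n. path_space))"
        using A by (intro sets_PiM_I_finite) auto
      have m: "W_path -` Pi\<^sub>E UNIV A \<inter> space (P \<pi>) \<in> sets (P \<pi>)"
        by (rule measurable_sets[OF W_path_measurable[OF \<pi>] AP])
      have "emeasure ?L (Pi\<^sub>E UNIV A)
        = emeasure (density (P \<pi>) (indicator {\<omega> \<in> space M. Y_true \<omega> = y})) (W_path -` Pi\<^sub>E UNIV A \<inter> space (P \<pi>))"
        by (subst emeasure_distr) (use AP in auto)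
      also have "\<dots> = emeasure (P \<pi>) ({\<omega> \<in> space M. Y_true \<omega> = y} \<inter> (W_path -` Pi\<^sub>E UNIV A \<inter> space (P \<pi>)))"
        using m Ey by (subst emeasure_density) (auto simp flip: indicator_inter_arith intro: nn_integral_indicator)
      also have "{\<omega> \<in> space M. Y_true \<omega> = y} \<inter> (W_path -` Pi\<^sub>E UNIV A \<inter> space (P \<pi>)) =
         {\<omega> \<in> space M. Y_true \<omega> = y \<and> (\<forall>i. (\<lambda>s. W i s \<omega>) \<in> A i)}"
        by (auto simp: space_P[OF \<pi>] PiE_iff)
      finally show ?thesis by (simp add: emeasure_joint_rectangle[OF \<pi> A])
    qed
    show "emeasure ?L (Pi\<^sub>E UNIV A) = emeasure ?R (Pi\<^sub>E UNIV A)" if "\<And>i. i \<in> UNIV \<Longrightarrow> A i \<in> sets \<nu>" for A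
    proof -
      have A: "A i \<in> sets path_space" for i using that[of i] by simp
      have "Pi\<^sub>E UNIV A \<in> sets noise" using that by (intro sets_PiM_I_finite) auto
      then show ?thesis
        using that by (subst rect[OF A]) (simp add: emeasure_density nn_integral_cmult emeasure_PiM)
    qed
    show "range (\<lambda>_. Pi\<^sub>E UNIV (\<lambda>_. UNIV)) \<subseteq> prod_algebra UNIV (\<lambda>_::'n. \<nu>)"
      using sets_eq_imp_space_eq[OF sets_law] sets.top[of \<nu>]
      by (intro image_subsetI prod_algebraI_finite) auto
    show "(\<Union>i::nat. Pi\<^sub>E UNIV (\<lambda>_. UNIV)) = space noise"
      using sets_eq_imp_space_eq[OF sets_law] by (simp add: space_PiM)
    have "emeasure ?L (Pi\<^sub>E UNIV (\<lambda>_. UNIV)) = ennreal (prior_weight \<pi> y) * (\<Prod>i\<in>(UNIV::'n set). emeasure \<nu> UNIV)"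
      by (rule rect) (metis sets.top space_path_space)
    then show "emeasure ?L (Pi\<^sub>E UNIV (\<lambda>_. UNIV)) \<noteq> \<infinity>"
      using \<nu>.emeasure_space_1 sets_eq_imp_space_eq[OF sets_law] by simp
  qed simp_all
  have "(\<integral>\<^sup>+\<omega>. F (Y_true \<omega>) (W_path \<omega>) \<partial>P \<pi>) =
      (\<integral>\<^sup>+\<omega>. (\<Sum>y\<in>UNIV. indicator {\<omega> \<in> space M. Y_true \<omega> = y} \<omega> * F y (W_path \<omega>)) \<partial>P \<pi>)"
  proof (rule nn_integral_cong)
    fix \<omega> assume "\<omega> \<in> space (P \<pi>)"
    then have "(\<Sum>y\<in>UNIV. indicator {\<omega> \<in> space M. Y_true \<omega> = y} \<omega> * F y (W_path \<omega>))
      = (\<Sum>y\<in>UNIV. if Y_true \<omega> = y then F y (W_path \<omega>) else 0)"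
      by (intro sum.cong) (auto simp: space_P[OF \<pi>])
    then show "F (Y_true \<omega>) (W_path \<omega>) = (\<Sum>y\<in>UNIV. indicator {\<omega> \<in> space M. Y_true \<omega> = y} \<omega> * F y (W_path \<omega>))"
      by simp
  qed
  also have "\<dots> = (\<Sum>y\<in>UNIV. \<integral>\<^sup>+\<omega>. indicator {\<omega> \<in> space M. Y_true \<omega> = y} \<omega> * F y (W_path \<omega>) \<partial>P \<pi>)"
    unfolding space_P[OF \<pi>, symmetric] by (rule nn_integral_sum) measurable
  also have "\<dots> = (\<Sum>y\<in>UNIV. ennreal (prior_weight \<pi> y) * (\<integral>\<^sup>+w. F y w \<partial>noise))"
  proof (rule sum.cong[OF refl])
    fix y
    have m: "(\<lambda>\<omega>. indicator {\<omega> \<in> space M. Y_true \<omega> = y} \<omega> :: ennreal) \<in> borel_measurable (P \<pi>)"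
      unfolding space_P[OF \<pi>, symmetric] by measurable
    have "(\<integral>\<^sup>+\<omega>. indicator {\<omega> \<in> space M. Y_true \<omega> = y} \<omega> * F y (W_path \<omega>) \<partial>P \<pi>)
      = (\<integral>\<^sup>+\<omega>. F y (W_path \<omega>) \<partial>density (P \<pi>) (indicator {\<omega> \<in> space M. Y_true \<omega> = y}))"
      by (rule nn_integral_density[symmetric]) (use m in measurable)
    also have "\<dots> = (\<integral>\<^sup>+w. F y w \<partial>distr (density (P \<pi>) (indicator {\<omega> \<in> space M. Y_true \<omega> = y})) noise W_path)"
      by (rule nn_integral_distr[symmetric]) measurable
    also have "\<dots> = ennreal (prior_weight \<pi> y) * (\<integral>\<^sup>+w. F y w \<partial>noise)"
      unfolding slice by (subst nn_integral_density) (auto simp: nn_integral_cmult)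
    finally show "(\<integral>\<^sup>+\<omega>. indicator {\<omega> \<in> space M. Y_true \<omega> = y} \<omega> * F y (W_path \<omega>) \<partial>P \<pi>)
        = ennreal (prior_weight \<pi> y) * (\<integral>\<^sup>+w. F y w \<partial>noise)" .
  qed
  finally show ?thesis .
qed

end

section \<open>Decision rules and the posterior\<close>

text \<open>A stopping time with a terminal verdict for each channel, defined on all of path space
  so that one rule serves every prior and every model. The last condition says that verdict
  \<open>i\<close> is known when the rule stops at \<open>t\<close>. Finitely many stopping values
  allow stopped quantities to be treated one fixed time at a time.\<close>

definition decision_rules :: "((('n \<Rightarrow> real \<Rightarrow> real) \<Rightarrow> real) \<times> (('n \<Rightarrow> real \<Rightarrow> real) \<Rightarrow> 'n \<Rightarrow> bool)) set" where
  "decision_rules = {(\<tau>, D). finite (range \<tau>) \<and> (\<forall>x. 0 \<le> \<tau> x) \<and>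
     (\<forall>t. {x. \<tau> x = t} \<in> sets (canonical_filtration (ennreal t))) \<and>
     (\<forall>t i. {x. \<tau> x = t \<and> D x i} \<in> sets (canonical_filtration (ennreal t)))}"

definition loss :: "real \<Rightarrow> ('a \<Rightarrow> real) \<times> ('a \<Rightarrow> 'n::finite \<Rightarrow> bool) \<Rightarrow> ('n \<Rightarrow> bool) \<Rightarrow> 'a \<Rightarrow> real" where
  "loss c r y x = (\<Sum>i\<in>UNIV. of_bool (snd r x i \<noteq> y i)) + c * fst r x"

text \<open>The frequentist risk at \<open>y\<close>. It sees the model only through the drifts and
  the noise law, which makes different models comparable.\<close>

definition risk :: "real ^ 'n \<Rightarrow> (real \<Rightarrow> real) measure \<Rightarrow> real \<Rightarrow>
    (('n::finite \<Rightarrow> real \<Rightarrow> real) \<Rightarrow> real) \<times> (('n \<Rightarrow> real \<Rightarrow> real) \<Rightarrow> 'n \<Rightarrow> bool) \<Rightarrow> ('n \<Rightarrow> bool) \<Rightarrow> ennreal" where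
  "risk \<mu> \<nu> c r y = (\<integral>\<^sup>+w. ennreal (loss c r y (drift \<mu> y w)) \<partial>PiM UNIV (\<lambda>_. \<nu>))"

definition bayes_risk :: "real ^ 'n \<Rightarrow> (real \<Rightarrow> real) measure \<Rightarrow> real \<Rightarrow>
    (('n::finite \<Rightarrow> real \<Rightarrow> real) \<Rightarrow> real) \<times> (('n \<Rightarrow> real \<Rightarrow> real) \<Rightarrow> 'n \<Rightarrow> bool) \<Rightarrow> real ^ 'n \<Rightarrow> ennreal" where
  "bayes_risk \<mu> \<nu> c r \<pi> = (\<Sum>y\<in>UNIV. ennreal (prior_weight \<pi> y) * risk \<mu> \<nu> c r y)"

lemma decision_rulesD:
  assumes "(\<tau>, D) \<in> decision_rules"
  shows "finite (range \<tau>)" "0 \<le> \<tau> x" "{x. \<tau> x = t} \<in> sets (canonical_filtration (ennreal t))"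
    "{x. \<tau> x = t \<and> D x i} \<in> sets (canonical_filtration (ennreal t))"
  using assms by (auto simp: decision_rules_def)

lemma decision_rules_measurable:
  fixes D :: "('n \<Rightarrow> real \<Rightarrow> real) \<Rightarrow> 'n \<Rightarrow> bool"
  assumes r: "(\<tau>, D) \<in> decision_rules"
  shows "\<tau> \<in> borel_measurable (canonical_filtration top)"
    and "Measurable.pred (canonical_filtration top) (\<lambda>x. D x i)"
proof -
  note D = decision_rulesD[OF r]
  have top: "sets (canonical_filtration (ennreal t)) \<subseteq> sets (canonical_filtration top)" for t
    by (rule canonical_filtration_mono) simp
  show "\<tau> \<in> borel_measurable (canonical_filtration top)"
  proof (rule measurableI)
    fix B :: "real set"
    have "\<tau> -` B = (\<Union>t\<in>range \<tau> \<inter> B. {x. \<tau> x = t})" by auto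
    also have "\<dots> \<in> sets (canonical_filtration top)"
      using D(1) top D(3) by (intro sets.finite_UN) blast+
    finally show "\<tau> -` B \<inter> space (canonical_filtration top) \<in> sets (canonical_filtration top)" by simp
  qed simp
  have "{x. D x i} = (\<Union>t\<in>range \<tau>. {x. \<tau> x = t \<and> D x i})" by auto
  also have "\<dots> \<in> sets (canonical_filtration top)"
    using D top by (intro sets.finite_UN) blast+
  finally show "Measurable.pred (canonical_filtration top) (\<lambda>x. D x i)" by (simp add: pred_def)
qed

lemma loss_measurable:
  fixes r :: "(('n::finite \<Rightarrow> real \<Rightarrow> real) \<Rightarrow> real) \<times> (('n \<Rightarrow> real \<Rightarrow> real) \<Rightarrow> 'n \<Rightarrow> bool)"
  assumes "r \<in> decision_rules"
  shows "(\<lambda>x. loss c r y x) \<in> borel_measurable (PiM UNIV (\<lambda>_. path_space))"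
proof -
  obtain \<tau> D where r: "r = (\<tau>, D)" by (cases r)
  note [measurable] = decision_rules_measurable[OF assms[unfolded r]]
  have "(\<lambda>x. loss c r y x) \<in> borel_measurable (canonical_filtration top)"
    unfolding loss_def r fst_conv snd_conv by measurable
  from measurable_compose[OF measurable_PiM_canonical_filtration this] show ?thesis by simp
qed

lemma loss_drift_measurable:
  fixes r :: "(('n::finite \<Rightarrow> real \<Rightarrow> real) \<Rightarrow> real) \<times> (('n \<Rightarrow> real \<Rightarrow> real) \<Rightarrow> 'n \<Rightarrow> bool)"
  assumes "r \<in> decision_rules"
  shows "(\<lambda>w. loss c r y (drift \<mu> y w)) \<in> borel_measurable (PiM UNIV (\<lambda>_. path_space))"
  by (rule measurable_compose[OF measurable_drift loss_measurable[OF assms]])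

text \<open>The loss is bounded: each channel contributes at most one error, and the stopping values
  have a maximum. Finiteness later allows risks to be used as real coefficients.\<close>

lemma risk_finite:
  assumes "r \<in> decision_rules" "0 \<le> c" "prob_space \<nu>"
  shows "risk \<mu> \<nu> c r y < \<infinity>"
proof -
  obtain \<tau> D where r: "r = (\<tau>, D)" by (cases r)
  interpret prob_space "PiM UNIV (\<lambda>_::'a. \<nu>)"
    by (intro prob_space_PiM assms)
  note D = decision_rulesD[OF assms(1)[unfolded r]]
  have "loss c r y x \<le> CARD('a) + c * Max (range \<tau>)" for x
  proof -
    have "(\<Sum>i\<in>UNIV. of_bool (D x i \<noteq> y i)) \<le> (\<Sum>i\<in>(UNIV::'a set). 1 :: real)"
      by (intro sum_mono) auto
    moreover have "c * \<tau> x \<le> c * Max (range \<tau>)"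
      using D assms by (intro mult_left_mono Max_ge) auto
    ultimately show ?thesis by (simp add: loss_def r)
  qed
  then have "risk \<mu> \<nu> c r y \<le> (\<integral>\<^sup>+w. ennreal (CARD('a) + c * Max (range \<tau>)) \<partial>PiM UNIV (\<lambda>_::'a. \<nu>))"
    unfolding risk_def by (intro nn_integral_mono ennreal_leI) auto
  also have "\<dots> < \<infinity>" by (simp add: emeasure_space_1)
  finally show ?thesis .
qed

text \<open>The sets \<open>A t\<close> will be chosen from preimages under the observation, so off
  the observed paths they need not increase with \<open>t\<close>. Taking the first entry, with a
  forced stop at \<open>Max R\<close>, yields a stopping rule on every path regardless: whether it
  stops at \<open>t\<close> is decided by the sets up to \<open>t\<close>.\<close>

lemma first_entry_rule:
  fixes A :: "real \<Rightarrow> ('n \<Rightarrow> real \<Rightarrow> real) set"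
  assumes R: "finite R" "R \<noteq> {}" "R \<subseteq> {0..}"
    and A: "\<And>t. t \<in> R \<Longrightarrow> A t \<in> sets (canonical_filtration (ennreal t))"
    and B: "\<And>t i. t \<in> R \<Longrightarrow> B t i \<in> sets (canonical_filtration (ennreal t))"
  defines "\<tau> \<equiv> \<lambda>x. Min {t \<in> R. x \<in> A t \<or> t = Max R}"
  shows "(\<tau>, \<lambda>x i. x \<in> B (\<tau> x) i) \<in> decision_rules" "range \<tau> \<subseteq> R"
proof -
  have \<tau>: "\<tau> x \<in> {t \<in> R. x \<in> A t \<or> t = Max R}" for x
    unfolding \<tau>_def using R by (intro Min_in) (auto intro: Max_in)
  then show ran: "range \<tau> \<subseteq> R" by auto
  have eq: "{x. \<tau> x = t} \<in> sets (canonical_filtration (ennreal t))" if "t \<in> R" for t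
  proof -
    have "\<tau> x = t \<longleftrightarrow> (x \<in> A t \<or> t = Max R) \<and> (\<forall>s\<in>{s \<in> R. s < t}. x \<notin> A s)" for x
    proof
      assume *: "\<tau> x = t"
      have "x \<notin> A s" if "s \<in> {s \<in> R. s < t}" for s
      proof
        assume "x \<in> A s"
        then have "\<tau> x \<le> s" unfolding \<tau>_def using R that by (intro Min_le) auto
        then show False using that * by simp
      qed
      then show "(x \<in> A t \<or> t = Max R) \<and> (\<forall>s\<in>{s \<in> R. s < t}. x \<notin> A s)"
        using \<tau>[of x] * by auto
    next
      assume *: "(x \<in> A t \<or> t = Max R) \<and> (\<forall>s\<in>{s \<in> R. s < t}. x \<notin> A s)"
      show "\<tau> x = t" unfolding \<tau>_def
      proof (rule Min_eqI)
        fix s assume s: "s \<in> {t \<in> R. x \<in> A t \<or> t = Max R}"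
        show "t \<le> s"
        proof (rule ccontr)
          assume "\<not> t \<le> s"
          with s * have "s = Max R" by auto
          with Max_ge[OF R(1) \<open>t \<in> R\<close>] \<open>\<not> t \<le> s\<close> show False by simp
        qed
      qed (use R * that in auto)
    qed
    then have "{x. \<tau> x = t} = (if t = Max R then UNIV else A t) \<inter> (UNIV - (\<Union>s\<in>{s \<in> R. s < t}. A s))"
      by auto
    also have "\<dots> \<in> sets (canonical_filtration (ennreal t))"
    proof -
      have "A s \<in> sets (canonical_filtration (ennreal t))" if "s \<in> {s \<in> R. s < t}" for s
        using A[of s] subsetD[OF canonical_filtration_mono[OF ennreal_leI[of s t]], of "A s"] that by auto
      moreover have "UNIV \<in> sets (canonical_filtration (ennreal t) :: ('n \<Rightarrow> real \<Rightarrow> real) measure)"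
        using sets.top[of "canonical_filtration (ennreal t) :: ('n \<Rightarrow> real \<Rightarrow> real) measure"] by simp
      ultimately show ?thesis using A[OF that] R
        by (intro sets.Int sets.Diff sets.finite_UN) auto
    qed
    finally show ?thesis .
  qed
  have empty: "{x. \<tau> x = t} = {}" if "t \<notin> R" for t using that ran by auto
  have eqB: "{x. \<tau> x = t \<and> x \<in> B (\<tau> x) i} \<in> sets (canonical_filtration (ennreal t))" if "t \<in> R" for t i
  proof -
    have "{x. \<tau> x = t \<and> x \<in> B (\<tau> x) i} = {x. \<tau> x = t} \<inter> B t i" by auto
    with eq[OF that] B[OF that] show ?thesis by simp
  qed
  have "{x. \<tau> x = t} \<in> sets (canonical_filtration (ennreal t))"
    "{x. \<tau> x = t \<and> x \<in> B (\<tau> x) i} \<in> sets (canonical_filtration (ennreal t))" for t i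
    using eq[of t] eqB[of t i] empty[of t] by (cases "t \<in> R"; auto)+
  moreover have "finite (range \<tau>)" using ran R by (rule_tac finite_subset)
  moreover have "0 \<le> \<tau> x" for x using ran R by auto
  ultimately show "(\<tau>, \<lambda>x i. x \<in> B (\<tau> x) i) \<in> decision_rules"
    by (simp add: decision_rules_def)
qed

section \<open>Averaging the posterior at fixed times\<close>

context sequential_testing_law
begin

lemma FX_subset_P:
  assumes \<pi>: "\<pi> \<in> cbox 0 1"
  shows "sets (FX t) \<subseteq> sets (P \<pi>)"
proof -
  have "X i s -` B \<inter> space M \<in> sets (P \<pi>)" if "0 \<le> s" "B \<in> sets borel" for i s B
  proof -
    have "X i s \<in> borel_measurable (P \<pi>)"
    using W_brownian[OF \<pi>, of i] Y_measurable[of i] \<open>0 \<le> s\<close> unfolding X_def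
    by (auto simp: standard_brownian_motion_def measurable_cong_sets[OF sets_P[OF \<pi>] refl] intro!: borel_measurable_add borel_measurable_times)
    from measurable_sets[OF this \<open>B \<in> sets borel\<close>] show ?thesis by (simp add: space_P[OF \<pi>])
  qed
  then have "{X i s -` B \<inter> space M | i s B. 0 \<le> s \<and> ennreal s \<le> t \<and> B \<in> sets borel} \<subseteq> sets (P \<pi>)"
    by blast
  from sets.sigma_sets_subset[OF this] show ?thesis
    by (simp add: sets_FX_sigma_sets space_P[OF \<pi>])
qed

lemma subalgebra_FX: "\<pi> \<in> cbox 0 1 \<Longrightarrow> subalgebra (P \<pi>) (FX t)"
  using FX_subset_P by (simp add: subalgebra_def space_P)

lemma Post_measurable:
  assumes "\<pi> \<in> cbox 0 1" "0 \<le> t"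
  shows "(\<lambda>\<omega>. Post \<pi> t \<omega> $ i) \<in> borel_measurable (P \<pi>)"
  by (rule measurable_from_subalg[OF subalgebra_FX Post_adapted]) (use assms in auto)

lemma g_Post_measurable:
  assumes "\<pi> \<in> cbox 0 1" "0 \<le> t"
  shows "(\<lambda>\<omega>. g (Post \<pi> t \<omega>)) \<in> borel_measurable (P \<pi>)"
  unfolding g_def
  by (intro borel_measurable_sum borel_measurable_min borel_measurable_diff Post_measurable assms) auto

lemma Y_integrable:
  assumes "\<pi> \<in> cbox 0 1" shows "integrable (P \<pi>) (Y i)"
proof -
  interpret prob_space "P \<pi>" by (rule prob_space_P) fact
  have "Y i \<in> borel_measurable (P \<pi>)"
    using Y_measurable[of i] by (simp add: measurable_cong_sets[OF sets_P[OF assms] refl])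
  moreover have "AE \<omega> in P \<pi>. norm (Y i \<omega>) \<le> 1"
    using Y_values[of _ i] by (intro AE_I2) (force simp: space_P[OF assms])
  ultimately show ?thesis by (intro integrable_const_bound)
qed

lemma Post_bounds:
  assumes "\<pi> \<in> cbox 0 1" "0 \<le> t"
  shows "AE \<omega> in P \<pi>. 0 \<le> Post \<pi> t \<omega> $ i \<and> Post \<pi> t \<omega> $ i \<le> 1"
proof -
  interpret prob_space "P \<pi>" by (rule prob_space_P) fact
  interpret finite_measure_subalgebra "P \<pi>" "FX (ennreal t)"
    by standard (rule subalgebra_FX[OF assms(1)])
  have "0 \<le> Y i \<omega>" "Y i \<omega> \<le> 1" if "\<omega> \<in> space (P \<pi>)" for \<omega>
    using Y_values[of \<omega> i] that by (auto simp: space_P[OF assms(1)])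
  then have "AE \<omega> in P \<pi>. 0 \<le> Y i \<omega>" "AE \<omega> in P \<pi>. Y i \<omega> \<le> 1" by auto
  from real_cond_exp_ge_c[OF Y_integrable[OF assms(1)] this(1)]
    real_cond_exp_le_c[OF Y_integrable[OF assms(1)] this(2)] Post_cond_exp[OF assms, of i]
  show ?thesis by eventually_elim simp
qed

text \<open>The averaging property of conditional expectation, moved to nonnegative integrals. The
  almost sure bounds on the posterior ensure that \<open>ennreal\<close> truncates nothing in either
  identity.\<close>

lemma Post_set_nn_integral:
  assumes \<pi>: "\<pi> \<in> cbox 0 1" and t: "0 \<le> t" and C: "C \<in> sets (FX (ennreal t))"
  shows "(\<integral>\<^sup>+\<omega>. indicator C \<omega> * ennreal (Post \<pi> t \<omega> $ i) \<partial>P \<pi>)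
       = (\<integral>\<^sup>+\<omega>. indicator C \<omega> * ennreal (Y i \<omega>) \<partial>P \<pi>)" (is ?A)
    and "(\<integral>\<^sup>+\<omega>. indicator C \<omega> * ennreal (1 - Post \<pi> t \<omega> $ i) \<partial>P \<pi>)
       = (\<integral>\<^sup>+\<omega>. indicator C \<omega> * ennreal (1 - Y i \<omega>) \<partial>P \<pi>)" (is ?B)
proof -
  interpret prob_space "P \<pi>" by (rule prob_space_P) fact
  interpret finite_measure_subalgebra "P \<pi>" "FX (ennreal t)"
    by standard (rule subalgebra_FX[OF \<pi>])
  have CP: "C \<in> sets (P \<pi>)" using C FX_subset_P[OF \<pi>] by blast
  note Ym = borel_measurable_integrable[OF Y_integrable[OF \<pi>, of i]]
  note Pm = Post_measurable[OF \<pi> t, of i]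
  have Y01: "0 \<le> Y i \<omega>" "Y i \<omega> \<le> 1" if "\<omega> \<in> space (P \<pi>)" for \<omega>
    using Y_values[of \<omega> i] that by (auto simp: space_P[OF \<pi>])
  have P_int: "integrable (P \<pi>) (\<lambda>\<omega>. Post \<pi> t \<omega> $ i)"
    using Post_bounds[OF \<pi> t, of i] by (intro integrable_const_bound[where B=1] Pm) (auto elim: AE_mp)
  have intC: "integrable (P \<pi>) (\<lambda>\<omega>. indicator C \<omega> * f \<omega>)" if "integrable (P \<pi>) f" for f :: "_ \<Rightarrow> real"
    using integrable_mult_indicator[OF CP that] by simp
  have "(\<integral>\<omega>. indicator C \<omega> * Y i \<omega> \<partial>P \<pi>) = (\<integral>\<omega>. indicator C \<omega> * real_cond_exp (P \<pi>) (FX (ennreal t)) (Y i) \<omega> \<partial>P \<pi>)"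
    using real_cond_exp_intA[OF Y_integrable[OF \<pi>, of i] C] by (simp add: set_lebesgue_integral_def)
  also have "\<dots> = (\<integral>\<omega>. indicator C \<omega> * Post \<pi> t \<omega> $ i \<partial>P \<pi>)"
  proof (rule integral_cong_AE)
    show "AE \<omega> in P \<pi>. indicator C \<omega> * real_cond_exp (P \<pi>) (FX (ennreal t)) (Y i) \<omega> = indicator C \<omega> * Post \<pi> t \<omega> $ i"
      using Post_cond_exp[OF \<pi> t, of i] by eventually_elim simp
  qed (use CP Pm in measurable)
  finally have eq: "(\<integral>\<omega>. indicator C \<omega> * Post \<pi> t \<omega> $ i \<partial>P \<pi>) = (\<integral>\<omega>. indicator C \<omega> * Y i \<omega> \<partial>P \<pi>)" by simp
  have nn: "(\<integral>\<^sup>+\<omega>. indicator C \<omega> * ennreal (f \<omega>) \<partial>P \<pi>) = ennreal (\<integral>\<omega>. indicator C \<omega> * f \<omega> \<partial>P \<pi>)"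
    if "integrable (P \<pi>) f" "AE \<omega> in P \<pi>. 0 \<le> f \<omega>" for f :: "_ \<Rightarrow> real"
  proof -
    have "(\<integral>\<^sup>+\<omega>. indicator C \<omega> * ennreal (f \<omega>) \<partial>P \<pi>) = (\<integral>\<^sup>+\<omega>. ennreal (indicator C \<omega> * f \<omega>) \<partial>P \<pi>)"
      by (intro nn_integral_cong) (auto split: split_indicator)
    also have "\<dots> = ennreal (\<integral>\<omega>. indicator C \<omega> * f \<omega> \<partial>P \<pi>)"
      using that(2) by (intro nn_integral_eq_integral intC that(1)) (auto elim!: eventually_mono)
    finally show ?thesis .
  qed
  have aeP: "AE \<omega> in P \<pi>. 0 \<le> Post \<pi> t \<omega> $ i" "AE \<omega> in P \<pi>. 0 \<le> 1 - Post \<pi> t \<omega> $ i"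
    using Post_bounds[OF \<pi> t, of i] by (auto elim!: eventually_mono)
  have aeY: "AE \<omega> in P \<pi>. 0 \<le> Y i \<omega>" "AE \<omega> in P \<pi>. 0 \<le> 1 - Y i \<omega>"
    by (intro AE_I2, use Y01 in simp)+
  show ?A using aeP aeY by (simp add: nn P_int Y_integrable[OF \<pi>] eq)
  have int1: "integrable (P \<pi>) (\<lambda>\<omega>. indicator C \<omega> :: real)" using intC[of "\<lambda>_. 1"] by simp
  have "(\<integral>\<omega>. indicator C \<omega> * (1 - Post \<pi> t \<omega> $ i) \<partial>P \<pi>) = (\<integral>\<omega>. indicator C \<omega> * (1 - Y i \<omega>) \<partial>P \<pi>)"
    using int1 intC[OF P_int] intC[OF Y_integrable[OF \<pi>, of i]]
    by (simp add: right_diff_distrib eq)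
  then show ?B using aeP aeY P_int Y_integrable[OF \<pi>, of i] by (simp add: nn)
qed

end

lemma nn_integral_finite_partition:
  fixes f :: "'b \<Rightarrow> 'a \<Rightarrow> ennreal"
  assumes "finite R" and T: "\<And>\<omega>. \<omega> \<in> space M \<Longrightarrow> T \<omega> \<in> R"
    and A: "\<And>t. t \<in> R \<Longrightarrow> {\<omega> \<in> space M. T \<omega> = t} \<in> sets M"
    and f: "\<And>t. t \<in> R \<Longrightarrow> f t \<in> borel_measurable M"
  shows "(\<integral>\<^sup>+\<omega>. f (T \<omega>) \<omega> \<partial>M) = (\<Sum>t\<in>R. \<integral>\<^sup>+\<omega>. indicator {\<omega> \<in> space M. T \<omega> = t} \<omega> * f t \<omega> \<partial>M)"
proof -
  have "(\<integral>\<^sup>+\<omega>. f (T \<omega>) \<omega> \<partial>M) = (\<integral>\<^sup>+\<omega>. (\<Sum>t\<in>R. indicator {\<omega> \<in> space M. T \<omega> = t} \<omega> * f t \<omega>) \<partial>M)"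
  proof (rule nn_integral_cong)
    fix \<omega> assume \<omega>: "\<omega> \<in> space M"
    then have "(\<Sum>t\<in>R. indicator {\<omega> \<in> space M. T \<omega> = t} \<omega> * f t \<omega>) = (\<Sum>t\<in>R. if T \<omega> = t then f t \<omega> else 0)"
      by (intro sum.cong) auto
    then show "f (T \<omega>) \<omega> = (\<Sum>t\<in>R. indicator {\<omega> \<in> space M. T \<omega> = t} \<omega> * f t \<omega>)"
      using T[OF \<omega>] \<open>finite R\<close> by simp
  qed
  also have "\<dots> = (\<Sum>t\<in>R. \<integral>\<^sup>+\<omega>. indicator {\<omega> \<in> space M. T \<omega> = t} \<omega> * f t \<omega> \<partial>M)"
    by (intro nn_integral_sum borel_measurable_times_ennreal borel_measurable_indicator A f)
  finally show ?thesis .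
qed

context sequential_testing_law
begin

lemma FX_set_in_P: "\<pi> \<in> cbox 0 1 \<Longrightarrow> A \<in> sets (FX t) \<Longrightarrow> A \<in> sets (P \<pi>)"
  using FX_subset_P by blast

lemma Y_eq_one_set:
  assumes "\<pi> \<in> cbox 0 1" shows "Measurable.pred (P \<pi>) (\<lambda>\<omega>. Y i \<omega> = 1)"
  by (rule measurable_compose[OF Y_true_measurable[OF assms], of "\<lambda>y. y i"]) simp

text \<open>On the part of \<open>A\<close> where the verdict is 1 the error is
  \<open>1 - Y\<close>, on the rest it is \<open>Y\<close>. Both parts are known at time
  \<open>t\<close>, so the posterior may replace \<open>Y\<close> on each.\<close>

lemma Post_decision:
  assumes \<pi>: "\<pi> \<in> cbox 0 1" and t: "0 \<le> t"
    and A: "A \<in> sets (FX (ennreal t))" and B: "B \<in> sets (FX (ennreal t))"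
  shows "(\<integral>\<^sup>+\<omega>. indicator A \<omega> * ennreal (if \<omega> \<in> B then 1 - Post \<pi> t \<omega> $ i else Post \<pi> t \<omega> $ i) \<partial>P \<pi>)
    = (\<integral>\<^sup>+\<omega>. indicator A \<omega> * ennreal (of_bool ((\<omega> \<in> B) \<noteq> (Y i \<omega> = 1))) \<partial>P \<pi>)" (is "?l = ?r")
proof -
  have AB: "A \<inter> B \<in> sets (FX (ennreal t))" "A - B \<in> sets (FX (ennreal t))" using A B by auto
  have ABm: "(\<lambda>\<omega>. indicator (A \<inter> B) \<omega> :: ennreal) \<in> borel_measurable (P \<pi>)"
    "(\<lambda>\<omega>. indicator (A - B) \<omega> :: ennreal) \<in> borel_measurable (P \<pi>)"
    by (rule borel_measurable_indicator[OF FX_set_in_P[OF \<pi> AB(1)]],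
        rule borel_measurable_indicator[OF FX_set_in_P[OF \<pi> AB(2)]])
  have Ym: "Y i \<in> borel_measurable (P \<pi>)"
    using Y_integrable[OF \<pi>] by (rule borel_measurable_integrable)
  note Pm = Post_measurable[OF \<pi> t, of i]
  have "?l = (\<integral>\<^sup>+\<omega>. indicator (A \<inter> B) \<omega> * ennreal (1 - Post \<pi> t \<omega> $ i) +
      indicator (A - B) \<omega> * ennreal (Post \<pi> t \<omega> $ i) \<partial>P \<pi>)"
    by (intro nn_integral_cong) (auto split: split_indicator)
  also have "\<dots> = (\<integral>\<^sup>+\<omega>. indicator (A \<inter> B) \<omega> * ennreal (1 - Post \<pi> t \<omega> $ i) \<partial>P \<pi>) +
     (\<integral>\<^sup>+\<omega>. indicator (A - B) \<omega> * ennreal (Post \<pi> t \<omega> $ i) \<partial>P \<pi>)"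
    by (intro nn_integral_add borel_measurable_times_ennreal ABm measurable_compose[OF _ measurable_ennreal]
        borel_measurable_diff Pm) auto
  also have "\<dots> = (\<integral>\<^sup>+\<omega>. indicator (A \<inter> B) \<omega> * ennreal (1 - Y i \<omega>) \<partial>P \<pi>) +
     (\<integral>\<^sup>+\<omega>. indicator (A - B) \<omega> * ennreal (Y i \<omega>) \<partial>P \<pi>)"
    by (simp only: Post_set_nn_integral[OF \<pi> t AB(1)] Post_set_nn_integral[OF \<pi> t AB(2)])
  also have "\<dots> = (\<integral>\<^sup>+\<omega>. indicator (A \<inter> B) \<omega> * ennreal (1 - Y i \<omega>) + indicator (A - B) \<omega> * ennreal (Y i \<omega>) \<partial>P \<pi>)"
    by (intro nn_integral_add[symmetric] borel_measurable_times_ennreal ABm measurable_compose[OF _ measurable_ennreal]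
        borel_measurable_diff Ym) auto
  also have "\<dots> = ?r"
  proof (rule nn_integral_cong)
    fix \<omega> assume "\<omega> \<in> space (P \<pi>)"
    then have "Y i \<omega> = 0 \<or> Y i \<omega> = 1" using Y_values[of \<omega> i] by (simp add: space_P[OF \<pi>])
    then show "indicator (A \<inter> B) \<omega> * ennreal (1 - Y i \<omega>) + indicator (A - B) \<omega> * ennreal (Y i \<omega>)
        = indicator A \<omega> * ennreal (of_bool ((\<omega> \<in> B) \<noteq> (Y i \<omega> = 1)))"
      by (auto split: split_indicator)
  qed
  finally show ?thesis .
qed

lemma g_Post_nn_integral:
  assumes \<pi>: "\<pi> \<in> cbox 0 1" and t: "0 \<le> t" and A: "A \<in> sets (FX (ennreal t))"
  shows "(\<integral>\<^sup>+\<omega>. indicator A \<omega> * ennreal (g (Post \<pi> t \<omega>)) \<partial>P \<pi>)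
    = (\<Sum>i\<in>UNIV. \<integral>\<^sup>+\<omega>. indicator A \<omega> * ennreal (min (Post \<pi> t \<omega> $ i) (1 - Post \<pi> t \<omega> $ i)) \<partial>P \<pi>)"
proof -
  have ae: "AE \<omega> in P \<pi>. \<forall>i. 0 \<le> Post \<pi> t \<omega> $ i \<and> Post \<pi> t \<omega> $ i \<le> 1"
    by (rule eventually_all_finite) (rule Post_bounds[OF \<pi> t])
  have "(\<integral>\<^sup>+\<omega>. indicator A \<omega> * ennreal (g (Post \<pi> t \<omega>)) \<partial>P \<pi>)
    = (\<integral>\<^sup>+\<omega>. (\<Sum>i\<in>UNIV. indicator A \<omega> * ennreal (min (Post \<pi> t \<omega> $ i) (1 - Post \<pi> t \<omega> $ i))) \<partial>P \<pi>)"
  proof (rule nn_integral_cong_AE, use ae in eventually_elim)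
    case (elim \<omega>)
    then have "ennreal (g (Post \<pi> t \<omega>)) = (\<Sum>i\<in>UNIV. ennreal (min (Post \<pi> t \<omega> $ i) (1 - Post \<pi> t \<omega> $ i)))"
      unfolding g_def by (intro sum_ennreal[symmetric]) auto
    then show ?case by (simp add: sum_distrib_left)
  qed
  also have "\<dots> = (\<Sum>i\<in>UNIV. \<integral>\<^sup>+\<omega>. indicator A \<omega> * ennreal (min (Post \<pi> t \<omega> $ i) (1 - Post \<pi> t \<omega> $ i)) \<partial>P \<pi>)"
    by (intro nn_integral_sum borel_measurable_times_ennreal borel_measurable_indicator FX_set_in_P[OF \<pi> A]
        measurable_compose[OF _ measurable_ennreal] borel_measurable_min borel_measurable_diff Post_measurable[OF \<pi> t]) auto
  finally show ?thesis .
qed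

text \<open>The posterior is compared with the actual decision errors through its averaging property alone,
  so no explicit filter formula is needed.\<close>

lemma g_Post_decision:
  assumes \<pi>: "\<pi> \<in> cbox 0 1" and t: "0 \<le> t"
    and A: "A \<in> sets (FX (ennreal t))" and B: "\<And>i. B i \<in> sets (FX (ennreal t))"
  shows "(\<integral>\<^sup>+\<omega>. indicator A \<omega> * ennreal (g (Post \<pi> t \<omega>)) \<partial>P \<pi>)
      \<le> (\<integral>\<^sup>+\<omega>. indicator A \<omega> * ennreal (\<Sum>i\<in>UNIV. of_bool ((\<omega> \<in> B i) \<noteq> (Y i \<omega> = 1))) \<partial>P \<pi>)" (is "?l \<le> ?r")
    and "(\<And>i. B i = {\<omega> \<in> space M. Post \<pi> t \<omega> $ i > 1/2}) \<Longrightarrow>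
     (\<integral>\<^sup>+\<omega>. indicator A \<omega> * ennreal (g (Post \<pi> t \<omega>)) \<partial>P \<pi>)
      = (\<integral>\<^sup>+\<omega>. indicator A \<omega> * ennreal (\<Sum>i\<in>UNIV. of_bool ((\<omega> \<in> B i) \<noteq> (Y i \<omega> = 1))) \<partial>P \<pi>)"
proof -
  have m: "(\<lambda>\<omega>. indicator A \<omega> * ennreal (of_bool ((\<omega> \<in> B i) \<noteq> (Y i \<omega> = 1)))) \<in> borel_measurable (P \<pi>)" for i
  proof -
    note [measurable] = Y_eq_one_set[OF \<pi>] FX_set_in_P[OF \<pi> A] FX_set_in_P[OF \<pi> B]
    show ?thesis by measurable
  qed
  have "?r = (\<integral>\<^sup>+\<omega>. (\<Sum>i\<in>UNIV. indicator A \<omega> * ennreal (of_bool ((\<omega> \<in> B i) \<noteq> (Y i \<omega> = 1)))) \<partial>P \<pi>)"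
    by (intro nn_integral_cong) (subst sum_distrib_left[symmetric], subst sum_ennreal, simp_all only: of_bool_def, auto)
  also have "\<dots> = (\<Sum>i\<in>UNIV. \<integral>\<^sup>+\<omega>. indicator A \<omega> * ennreal (of_bool ((\<omega> \<in> B i) \<noteq> (Y i \<omega> = 1))) \<partial>P \<pi>)"
    by (rule nn_integral_sum) (rule m)
  also have "\<dots> = (\<Sum>i\<in>UNIV. \<integral>\<^sup>+\<omega>. indicator A \<omega> * ennreal (if \<omega> \<in> B i then 1 - Post \<pi> t \<omega> $ i else Post \<pi> t \<omega> $ i) \<partial>P \<pi>)"
    by (simp only: Post_decision[OF \<pi> t A B])
  finally have r: "?r = \<dots>" .
  show "?l \<le> ?r" unfolding r g_Post_nn_integral[OF \<pi> t A]
    by (intro sum_mono nn_integral_mono mult_left_mono ennreal_leI) auto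
  \<comment> \<open>Deciding for 1 exactly when the posterior exceeds 1/2 makes the conditional
    error the smaller of \<open>Post\<close> and \<open>1 - Post\<close>, so the lower bound is
    attained.\<close>
  show "?l = ?r" if Bi: "\<And>i. B i = {\<omega> \<in> space M. Post \<pi> t \<omega> $ i > 1/2}"
    unfolding r g_Post_nn_integral[OF \<pi> t A]
    by (intro sum.cong nn_integral_cong) (auto simp: Bi space_P[OF \<pi>] min_def)
qed

text \<open>Partitioning along the finitely many values of \<open>T\<close> reduces the random time
  to the fixed-time comparison, applied on the event \<open>T = t\<close>, which is known at time
  \<open>t\<close>.\<close>

lemma stopped_decision:
  assumes \<pi>: "\<pi> \<in> cbox 0 1" and R: "finite R" "R \<subseteq> {0..}"
    and T: "\<And>\<omega>. \<omega> \<in> space M \<Longrightarrow> T \<omega> \<in> R"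
    and A: "\<And>t. t \<in> R \<Longrightarrow> {\<omega> \<in> space M. T \<omega> = t} \<in> sets (FX (ennreal t))"
    and B: "\<And>t i. t \<in> R \<Longrightarrow> B t i \<in> sets (FX (ennreal t))"
  shows "(\<integral>\<^sup>+\<omega>. ennreal (g (Post \<pi> (T \<omega>) \<omega>)) \<partial>P \<pi>)
      \<le> (\<integral>\<^sup>+\<omega>. ennreal (\<Sum>i\<in>UNIV. of_bool ((\<omega> \<in> B (T \<omega>) i) \<noteq> (Y i \<omega> = 1))) \<partial>P \<pi>)" (is "?l \<le> ?r")
    and "(\<And>t i. t \<in> R \<Longrightarrow> B t i = {\<omega> \<in> space M. Post \<pi> t \<omega> $ i > 1/2}) \<Longrightarrow>
     (\<integral>\<^sup>+\<omega>. ennreal (g (Post \<pi> (T \<omega>) \<omega>)) \<partial>P \<pi>)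
      = (\<integral>\<^sup>+\<omega>. ennreal (\<Sum>i\<in>UNIV. of_bool ((\<omega> \<in> B (T \<omega>) i) \<noteq> (Y i \<omega> = 1))) \<partial>P \<pi>)"
proof -
  have AP: "{\<omega> \<in> space (P \<pi>). T \<omega> = t} \<in> sets (P \<pi>)" if "t \<in> R" for t
    using FX_set_in_P[OF \<pi> A[OF that]] by (simp add: space_P[OF \<pi>])
  have l: "?l = (\<Sum>t\<in>R. \<integral>\<^sup>+\<omega>. indicator {\<omega> \<in> space M. T \<omega> = t} \<omega> * ennreal (g (Post \<pi> t \<omega>)) \<partial>P \<pi>)"
    using R by (subst nn_integral_finite_partition[where R=R and T=T])
      (auto simp: space_P[OF \<pi>] T AP[unfolded space_P[OF \<pi>]] intro!: g_Post_measurable[OF \<pi>] measurable_compose[OF _ measurable_ennreal])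
  have m: "(\<lambda>\<omega>. ennreal (\<Sum>i\<in>UNIV. of_bool ((\<omega> \<in> B t i) \<noteq> (Y i \<omega> = 1)))) \<in> borel_measurable (P \<pi>)" if "t \<in> R" for t
  proof -
    note [measurable] = Y_eq_one_set[OF \<pi>] FX_set_in_P[OF \<pi> B[OF that]]
    show ?thesis by measurable
  qed
  have r: "?r = (\<Sum>t\<in>R. \<integral>\<^sup>+\<omega>. indicator {\<omega> \<in> space M. T \<omega> = t} \<omega> *
      ennreal (\<Sum>i\<in>UNIV. of_bool ((\<omega> \<in> B t i) \<noteq> (Y i \<omega> = 1))) \<partial>P \<pi>)"
    unfolding space_P[OF \<pi>, symmetric]
    by (rule nn_integral_finite_partition[OF R(1) _ AP m]) (use T in \<open>simp_all add: space_P[OF \<pi>]\<close>)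
  show "?l \<le> ?r" unfolding l r
    using R by (intro sum_mono g_Post_decision(1)[OF \<pi> _ A B]) auto
  show "?l = ?r" if "\<And>t i. t \<in> R \<Longrightarrow> B t i = {\<omega> \<in> space M. Post \<pi> t \<omega> $ i > 1/2}"
    unfolding l r using R that by (intro sum.cong g_Post_decision(2)[OF \<pi> _ A B]) auto
qed

text \<open>On \<open>Y_true = y\<close> the observation is the drifted noise, so the disintegration
  over the hypotheses applies to the loss of the observed path.\<close>

lemma bayes_risk_eq_expectation:
  assumes \<pi>: "\<pi> \<in> cbox 0 1" and r: "r \<in> decision_rules"
  shows "bayes_risk \<mu> \<nu> c r \<pi> = (\<integral>\<^sup>+\<omega>. ennreal (loss c r (Y_true \<omega>) (X_path \<omega>)) \<partial>P \<pi>)"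
proof -
  have "bayes_risk \<mu> \<nu> c r \<pi> = (\<integral>\<^sup>+\<omega>. ennreal (loss c r (Y_true \<omega>) (drift \<mu> (Y_true \<omega>) (W_path \<omega>))) \<partial>P \<pi>)"
    unfolding bayes_risk_def risk_def
    by (subst nn_integral_joint[OF \<pi>, where F="\<lambda>y w. ennreal (loss c r y (drift \<mu> y w))"])
       (auto intro!: measurable_compose[OF _ measurable_ennreal] loss_drift_measurable r)
  also have "\<dots> = (\<integral>\<^sup>+\<omega>. ennreal (loss c r (Y_true \<omega>) (X_path \<omega>)) \<partial>P \<pi>)"
    by (intro nn_integral_cong) (simp add: space_P[OF \<pi>] X_path_eq_drift)
  finally show ?thesis .
qed

lemma bayes_risk_split:
  assumes \<pi>: "\<pi> \<in> cbox 0 1" and r: "(\<tau>, D) \<in> decision_rules" and c: "0 \<le> c"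
  shows "bayes_risk \<mu> \<nu> c (\<tau>, D) \<pi> =
    (\<integral>\<^sup>+\<omega>. ennreal (\<Sum>i\<in>UNIV. of_bool (D (X_path \<omega>) i \<noteq> (Y i \<omega> = 1))) \<partial>P \<pi>) +
    (\<integral>\<^sup>+\<omega>. ennreal c * ennreal (\<tau> (X_path \<omega>)) \<partial>P \<pi>)"
    and "(\<lambda>\<omega>. \<tau> (X_path \<omega>)) \<in> borel_measurable (P \<pi>)"
proof -
  have X: "X_path \<in> P \<pi> \<rightarrow>\<^sub>M canonical_filtration top"
  proof (rule measurableI)
    fix A :: "('n \<Rightarrow> real \<Rightarrow> real) set" assume "A \<in> sets (canonical_filtration top)"
    then have "X_path -` A \<inter> space M \<in> sets (FX top)" unfolding sets_FX by blast
    from FX_set_in_P[OF \<pi> this] show "X_path -` A \<inter> space (P \<pi>) \<in> sets (P \<pi>)"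
      unfolding space_P[OF \<pi>] .
  qed simp
  have [measurable]: "(\<lambda>\<omega>. \<tau> (X_path \<omega>)) \<in> borel_measurable (P \<pi>)"
    "Measurable.pred (P \<pi>) (\<lambda>\<omega>. D (X_path \<omega>) i)" for i
    by (rule measurable_compose[OF X decision_rules_measurable(1)[OF r]],
        rule measurable_compose[OF X decision_rules_measurable(2)[OF r]])
  note [measurable] = Y_eq_one_set[OF \<pi>]
  show "(\<lambda>\<omega>. \<tau> (X_path \<omega>)) \<in> borel_measurable (P \<pi>)" by fact
  have "bayes_risk \<mu> \<nu> c (\<tau>, D) \<pi> =
    (\<integral>\<^sup>+\<omega>. ennreal (\<Sum>i\<in>UNIV. of_bool (D (X_path \<omega>) i \<noteq> (Y i \<omega> = 1))) + ennreal c * ennreal (\<tau> (X_path \<omega>)) \<partial>P \<pi>)"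
    unfolding bayes_risk_eq_expectation[OF \<pi> r] loss_def fst_conv snd_conv
    by (intro nn_integral_cong, subst ennreal_plus[OF sum_nonneg mult_nonneg_nonneg])
      (simp_all add: ennreal_mult decision_rulesD(2)[OF r] c)
  also have "\<dots> = (\<integral>\<^sup>+\<omega>. ennreal (\<Sum>i\<in>UNIV. of_bool (D (X_path \<omega>) i \<noteq> (Y i \<omega> = 1))) \<partial>P \<pi>) +
    (\<integral>\<^sup>+\<omega>. ennreal c * ennreal (\<tau> (X_path \<omega>)) \<partial>P \<pi>)"
    by (rule nn_integral_add) measurable
  finally show "bayes_risk \<mu> \<nu> c (\<tau>, D) \<pi> = \<dots>" .
qed

text \<open>Evaluated along the observation, a rule gives an admissible stopping time, and its
  verdicts have at least the expected number of errors of the best verdicts under the posterior,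
  which is the mean of \<open>g\<close>.\<close>

lemma V_le_bayes_risk:
  assumes \<pi>: "\<pi> \<in> cbox 0 1" and r: "r \<in> decision_rules" and c: "0 \<le> c"
  shows "V c \<pi> \<le> bayes_risk \<mu> \<nu> c r \<pi>"
proof -
  obtain \<tau> D where r': "r = (\<tau>, D)" by (cases r)
  note r = r[unfolded r'] note D = decision_rulesD[OF r]
  let ?\<sigma> = "\<lambda>\<omega>. ennreal (\<tau> (X_path \<omega>))"
  have eq: "{\<omega> \<in> space M. \<tau> (X_path \<omega>) = t} \<in> sets (FX (ennreal t))" for t
    using D(3)[of t] by (auto simp: sets_FX intro!: exI[of _ "{x. \<tau> x = t}"])
  have st: "stopping_time FX ?\<sigma>"
    unfolding stopping_time_def pred_def space_FX
  proof
    fix t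
    have "{\<omega> \<in> space M. ?\<sigma> \<omega> \<le> t} = (\<Union>s\<in>{s \<in> range \<tau>. ennreal s \<le> t}. {\<omega> \<in> space M. \<tau> (X_path \<omega>) = s})"
      by auto
    also have "\<dots> \<in> sets (FX t)"
    proof (rule sets.finite_UN)
      fix s assume "s \<in> {s \<in> range \<tau>. ennreal s \<le> t}"
      then show "{\<omega> \<in> space M. \<tau> (X_path \<omega>) = s} \<in> sets (FX t)"
        using eq[of s] FX_mono[of "ennreal s" t] by auto
    qed (use D(1) in simp)
    finally show "{\<omega> \<in> space M. ?\<sigma> \<omega> \<le> t} \<in> sets (FX t)" .
  qed
  then have "V c \<pi> \<le> (\<integral>\<^sup>+ \<omega>. (ennreal (g (Post \<pi> (enn2real (?\<sigma> \<omega>)) \<omega>)) + ennreal c * ?\<sigma> \<omega>) \<partial>P \<pi>)"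
    unfolding V_def by (intro INF_lower2[of ?\<sigma>]) auto
  also have "\<dots> = (\<integral>\<^sup>+ \<omega>. (ennreal (g (Post \<pi> (\<tau> (X_path \<omega>)) \<omega>)) + ennreal c * ennreal (\<tau> (X_path \<omega>))) \<partial>P \<pi>)"
    by (simp add: D(2))
  also have "\<dots> = (\<integral>\<^sup>+ \<omega>. ennreal (g (Post \<pi> (\<tau> (X_path \<omega>)) \<omega>)) \<partial>P \<pi>) + (\<integral>\<^sup>+ \<omega>. ennreal c * ennreal (\<tau> (X_path \<omega>)) \<partial>P \<pi>)"
  proof (rule nn_integral_add)
    have "(\<lambda>\<omega>. g (Post \<pi> (\<tau> (X_path \<omega>)) \<omega>)) \<in> borel_measurable (P \<pi>)"
    proof (rule measurable_compose_countable'[where I="range \<tau>" and g="\<lambda>\<omega>. \<tau> (X_path \<omega>)"])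
      show "(\<lambda>\<omega>. \<tau> (X_path \<omega>)) \<in> P \<pi> \<rightarrow>\<^sub>M count_space (range \<tau>)"
        using FX_set_in_P[OF \<pi> eq]
        by (simp add: measurable_count_space_eq2[OF D(1)] vimage_def Int_def conj_commute space_P[OF \<pi>])
      show "countable (range \<tau>)" using D(1) by (rule countable_finite)
      fix t assume "t \<in> range \<tau>"
      then have "0 \<le> t" using D(2) by auto
      then show "(\<lambda>\<omega>. g (Post \<pi> t \<omega>)) \<in> borel_measurable (P \<pi>)" by (rule g_Post_measurable[OF \<pi>])
    qed
    then show "(\<lambda>\<omega>. ennreal (g (Post \<pi> (\<tau> (X_path \<omega>)) \<omega>))) \<in> borel_measurable (P \<pi>)" by measurable
    note [measurable] = bayes_risk_split(2)[OF \<pi> r c]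
    show "(\<lambda>\<omega>. ennreal c * ennreal (\<tau> (X_path \<omega>))) \<in> borel_measurable (P \<pi>)" by measurable
  qed
  also have "\<dots> \<le> bayes_risk \<mu> \<nu> c (\<tau>, D) \<pi>"
  proof -
    \<comment> \<open>Intersecting with the stopping event matters: the verdict is guaranteed to be
      known at time \<open>t\<close> only if the rule stops at \<open>t\<close>.\<close>
    let ?B = "\<lambda>t i. {\<omega> \<in> space M. \<tau> (X_path \<omega>) = t \<and> D (X_path \<omega>) i}"
    have "?B t i \<in> sets (FX (ennreal t))" for t i
      using D(4)[of t i] by (auto simp: sets_FX intro!: exI[of _ "{x. \<tau> x = t \<and> D x i}"])
    then have "(\<integral>\<^sup>+ \<omega>. ennreal (g (Post \<pi> (\<tau> (X_path \<omega>)) \<omega>)) \<partial>P \<pi>)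
      \<le> (\<integral>\<^sup>+\<omega>. ennreal (\<Sum>i\<in>UNIV. of_bool ((\<omega> \<in> ?B (\<tau> (X_path \<omega>)) i) \<noteq> (Y i \<omega> = 1))) \<partial>P \<pi>)"
      using D(2) by (intro stopped_decision(1)[OF \<pi> D(1) _ _ eq, where B="?B"]) auto
    also have "\<dots> = (\<integral>\<^sup>+\<omega>. ennreal (\<Sum>i\<in>UNIV. of_bool (D (X_path \<omega>) i \<noteq> (Y i \<omega> = 1))) \<partial>P \<pi>)"
      by (intro nn_integral_cong) (auto simp: space_P[OF \<pi>])
    finally show ?thesis unfolding bayes_risk_split(1)[OF \<pi> r c] by (rule add_right_mono)
  qed
  finally show ?thesis by (simp add: r')
qed

end

section \<open>Discretisation of stopping times\<close>

text \<open>Mesh \<open>1/(m+1)\<close> up to the horizon \<open>m+1\<close>. Both mesh and horizon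
  must improve with \<open>m\<close>, hence the \<open>(m+1)^2\<close> steps.\<close>

definition time_grid :: "nat \<Rightarrow> real set" where
  "time_grid m = (\<lambda>k. real k / real (Suc m)) ` {..(Suc m)\<^sup>2}"

text \<open>Rounding goes upwards, so that a rounded stopping time does not anticipate. Values past
  the horizon, infinity included, are cut to the last grid point, where the decision is
  forced.\<close>

definition grid_time :: "nat \<Rightarrow> ennreal \<Rightarrow> real" where
  "grid_time m s = Min {t \<in> time_grid m. s \<le> ennreal t \<or> t = Max (time_grid m)}"

lemma time_grid: "finite (time_grid m)" "time_grid m \<noteq> {}" "time_grid m \<subseteq> {0..}"
  by (auto simp: time_grid_def)

lemma Max_time_grid: "Max (time_grid m) = real (Suc m)"
proof (rule Max_eqI[OF time_grid(1)])
  show "t \<le> real (Suc m)" if "t \<in> time_grid m" for t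
  proof -
    from that obtain k where k: "k \<le> (Suc m)\<^sup>2" "t = real k / real (Suc m)" by (auto simp: time_grid_def)
    from k(1) have "real k \<le> real (Suc m) * real (Suc m)"
      unfolding power2_eq_square by (metis of_nat_le_iff of_nat_mult)
    then show ?thesis by (simp add: k(2) divide_le_eq)
  qed
  have "real (Suc m) = real ((Suc m)\<^sup>2) / real (Suc m)"     by (simp only: power2_eq_square of_nat_mult, simp del: of_nat_Suc)
  then show "real (Suc m) \<in> time_grid m" unfolding time_grid_def by blast
qed

lemma grid_time_in:
  "grid_time m s \<in> {t \<in> time_grid m. s \<le> ennreal t \<or> t = Max (time_grid m)}"
  unfolding grid_time_def using time_grid[of m] Max_in[OF time_grid(1,2)]
  by (intro Min_in) auto

lemma grid_time_nonneg: "0 \<le> grid_time m s"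
  using grid_time_in[of m s] time_grid(3)[of m] by auto

lemma grid_time_le: "t \<in> time_grid m \<Longrightarrow> s \<le> ennreal t \<Longrightarrow> grid_time m s \<le> t"
  unfolding grid_time_def using time_grid[of m] by (intro Min_le) auto

lemma grid_time_bounds:
  assumes "0 \<le> a" "a \<le> real (Suc m)"
  shows "a \<le> grid_time m (ennreal a)" "grid_time m (ennreal a) \<le> a + 1 / real (Suc m)"
proof -
  show "a \<le> grid_time m (ennreal a)"
    using grid_time_in[of m "ennreal a"] assms grid_time_nonneg[of m "ennreal a"]
    by (auto simp: Max_time_grid)
  define k where "k = nat \<lceil>a * real (Suc m)\<rceil>"
  have k: "a * real (Suc m) \<le> real k" "real k \<le> a * real (Suc m) + 1"
    using assms unfolding k_def by (auto simp: of_nat_nat)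
  have "a * real (Suc m) \<le> real ((Suc m)\<^sup>2)"
    using mult_right_mono[OF assms(2), of "real (Suc m)"]    unfolding power2_eq_square of_nat_mult by simp
  then have "\<lceil>a * real (Suc m)\<rceil> \<le> int ((Suc m)\<^sup>2)" by (simp add: ceiling_le_iff del: of_nat_power)
  then have "k \<le> (Suc m)\<^sup>2" unfolding k_def by linarith
  then have "real k / real (Suc m) \<in> time_grid m" by (auto simp: time_grid_def)
  moreover have "a \<le> real k / real (Suc m)" using k by (simp add: field_simps)
  ultimately have "grid_time m (ennreal a) \<le> real k / real (Suc m)"
    by (intro grid_time_le) (auto intro: ennreal_leI)
  also have "\<dots> \<le> a + 1 / real (Suc m)"
    using divide_right_mono[OF k(2), of "real (Suc m)"] by (simp add: add_divide_distrib del: of_nat_Suc)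
  finally show "grid_time m (ennreal a) \<le> a + 1 / real (Suc m)" .
qed

text \<open>Truncation at the horizon only lowers the time, so one mesh is the largest possible
  increase.\<close>

lemma ennreal_grid_time_le: "ennreal (grid_time m s) \<le> s + ennreal (1 / real (Suc m))"
proof (cases s)
  case (real a)
  have "grid_time m s \<le> a + 1 / real (Suc m)"
  proof (cases "a \<le> real (Suc m)")
    case False
    have "grid_time m s \<le> real (Suc m)"
      using grid_time_in[of m s] Max_ge[OF time_grid(1), of "grid_time m s" m] by (simp add: Max_time_grid)
    moreover have "0 \<le> 1 / real (Suc m)" by simp
    ultimately show ?thesis using False by linarith
  qed (use grid_time_bounds real in simp)
  then have "ennreal (grid_time m s) \<le> ennreal (a + 1 / real (Suc m))" by (rule ennreal_leI)
  also have "\<dots> = s + ennreal (1 / real (Suc m))" using real by (subst ennreal_plus) auto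
  finally show ?thesis .
qed simp

lemma grid_time_tendsto:
  assumes "s < \<infinity>" shows "(\<lambda>m. grid_time m s) \<longlonglongrightarrow> enn2real s"
proof (cases s)
  case (real a)
  have ev: "\<forall>\<^sub>F m in sequentially. a \<le> real (Suc m)"
  proof -
    obtain N where "a \<le> real N" using real_arch_simple by blast
    then have "\<forall>m\<ge>N. a \<le> real (Suc m)" by auto
    then show ?thesis by (auto simp: eventually_sequentially)
  qed
  have "(\<lambda>m. grid_time m s) \<longlonglongrightarrow> a"
  proof (rule tendsto_sandwich)
    show "\<forall>\<^sub>F m in sequentially. a \<le> grid_time m s" "\<forall>\<^sub>F m in sequentially. grid_time m s \<le> a + 1 / real (Suc m)"
      using ev by (eventually_elim, use real grid_time_bounds in simp)+
    show "(\<lambda>m. a + 1 / real (Suc m)) \<longlonglongrightarrow> a"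
      using tendsto_add[OF tendsto_const LIMSEQ_inverse_real_of_nat, of a] by (simp add: inverse_eq_divide)
  qed simp
  then show ?thesis using real by simp
qed (use assms in simp)

section \<open>Approximation of stopping times by rules\<close>

context sequential_testing_law
begin

lemma stopping_time_measurable:
  assumes "\<pi> \<in> cbox 0 1" "stopping_time FX \<sigma>"
  shows "\<sigma> \<in> borel_measurable (P \<pi>)"
proof (rule borel_measurableI_le)
  fix t
  have "{\<omega> \<in> space M. \<sigma> \<omega> \<le> t} \<in> sets (FX t)" using assms(2) by (simp add: stopping_time_def pred_def)
  from FX_set_in_P[OF assms(1) this] show "{\<omega> \<in> space (P \<pi>). \<sigma> \<omega> \<le> t} \<in> sets (P \<pi>)"
    unfolding space_P[OF assms(1)] .
qed

lemma g_le_card: "g x \<le> real CARD('n)"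
proof -
  have "g x \<le> (\<Sum>i\<in>(UNIV :: 'n set). 1)" unfolding g_def by (intro sum_mono) auto
  then show ?thesis by simp
qed

lemma continuous_g: "continuous_on UNIV g"
  unfolding g_def by (intro continuous_intros)

lemma g_Post_tendsto:
  assumes \<pi>: "\<pi> \<in> cbox 0 1" and \<omega>: "\<omega> \<in> space M" and T: "T \<longlonglongrightarrow> a" "\<And>m. 0 \<le> T m"
  shows "(\<lambda>m. g (Post \<pi> (T m) \<omega>)) \<longlonglongrightarrow> g (Post \<pi> a \<omega>)"
proof -
  have a: "0 \<le> a" using T by (intro LIMSEQ_le_const) auto
  have "(\<lambda>m. Post \<pi> (T m) \<omega>) \<longlonglongrightarrow> Post \<pi> a \<omega>"
    using continuous_on_tendsto_compose[OF Post_continuous[OF \<pi> \<omega>] T(1)] a T(2) by simp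
  then show ?thesis by (intro continuous_on_tendsto_compose[OF continuous_g]) auto
qed

text \<open>The rounded stopping time and the threshold verdicts of the posterior are both expressed
  through canonical sets of paths; the threshold verdicts turn the expected error count into the
  mean of \<open>g\<close> exactly. The rule so found depends on \<open>\<pi>\<close>, but it
  belongs to the common class.\<close>

lemma grid_rule:
  assumes \<pi>: "\<pi> \<in> cbox 0 1" and \<sigma>: "stopping_time FX \<sigma>" and c: "0 \<le> c"
  shows "\<exists>r\<in>decision_rules. bayes_risk \<mu> \<nu> c r \<pi> =
      (\<integral>\<^sup>+\<omega>. ennreal (g (Post \<pi> (grid_time m (\<sigma> \<omega>)) \<omega>)) \<partial>P \<pi>) +
      (\<integral>\<^sup>+\<omega>. ennreal c * ennreal (grid_time m (\<sigma> \<omega>)) \<partial>P \<pi>)"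
    and "(\<lambda>\<omega>. g (Post \<pi> (grid_time m (\<sigma> \<omega>)) \<omega>)) \<in> borel_measurable (P \<pi>)"
proof -
  have "\<exists>A. A \<in> sets (canonical_filtration (ennreal t)) \<and> {\<omega> \<in> space M. \<sigma> \<omega> \<le> ennreal t} = X_path -` A \<inter> space M" for t
  proof -
    have "{\<omega> \<in> space M. \<sigma> \<omega> \<le> ennreal t} \<in> sets (FX (ennreal t))" using \<sigma> by (simp add: stopping_time_def pred_def)
    then show ?thesis unfolding sets_FX by blast
  qed
  then obtain A where A: "\<And>t. A t \<in> sets (canonical_filtration (ennreal t))"
      "\<And>t. {\<omega> \<in> space M. \<sigma> \<omega> \<le> ennreal t} = X_path -` A t \<inter> space M"
    by metis
  \<comment> \<open>Adaptedness of the posterior is known for nonnegative times; an empty dummy set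
    covers the others, so that one choice function serves all \<open>t\<close>.\<close>
  have "\<exists>B. B \<in> sets (canonical_filtration (ennreal t)) \<and>
      (0 \<le> t \<longrightarrow> {\<omega> \<in> space M. Post \<pi> t \<omega> $ i > 1/2} = X_path -` B \<inter> space M)" for t i
  proof (cases "0 \<le> t")
    case True
    have "(\<lambda>\<omega>. Post \<pi> t \<omega> $ i) -` {1/2<..} \<inter> space (FX (ennreal t)) \<in> sets (FX (ennreal t))"
      by (rule measurable_sets[OF Post_adapted[OF \<pi> True]]) simp
    moreover have "(\<lambda>\<omega>. Post \<pi> t \<omega> $ i) -` {1/2<..} \<inter> space (FX (ennreal t)) = {\<omega> \<in> space M. Post \<pi> t \<omega> $ i > 1/2}"
      by auto
    ultimately have "{\<omega> \<in> space M. Post \<pi> t \<omega> $ i > 1/2} \<in> sets (FX (ennreal t))" by simp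
    then show ?thesis unfolding sets_FX by blast
  next
    case False
    then show ?thesis by (intro exI[of _ "{}"]) simp
  qed
  then have "\<forall>t i. \<exists>B. B \<in> sets (canonical_filtration (ennreal t)) \<and>
      (0 \<le> t \<longrightarrow> {\<omega> \<in> space M. Post \<pi> t \<omega> $ i > 1/2} = X_path -` B \<inter> space M)"
    by blast
  from this[unfolded choice_iff]
  obtain B where B': "\<forall>t i. B t i \<in> sets (canonical_filtration (ennreal t)) \<and>
      (0 \<le> t \<longrightarrow> {\<omega> \<in> space M. Post \<pi> t \<omega> $ i > 1/2} = X_path -` B t i \<inter> space M)"
    by (elim exE)
  have B: "B t i \<in> sets (canonical_filtration (ennreal t))"
      "0 \<le> t \<Longrightarrow> {\<omega> \<in> space M. Post \<pi> t \<omega> $ i > 1/2} = X_path -` B t i \<inter> space M" for t i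
    using B' by simp_all
  define \<tau> where "\<tau> = (\<lambda>x. Min {t \<in> time_grid m. x \<in> A t \<or> t = Max (time_grid m)})"
  let ?D = "\<lambda>x i. x \<in> B (\<tau> x) i"
  have r: "(\<tau>, ?D) \<in> decision_rules" and ran: "range \<tau> \<subseteq> time_grid m"
    unfolding \<tau>_def
    by (rule first_entry_rule(1)[where R="time_grid m" and A=A and B=B, OF time_grid A(1) B(1)],
        rule first_entry_rule(2)[where R="time_grid m" and A=A and B=B, OF time_grid A(1) B(1)])
  let ?T = "\<lambda>\<omega>. grid_time m (\<sigma> \<omega>)"
  have T: "\<tau> (X_path \<omega>) = ?T \<omega>" if "\<omega> \<in> space M" for \<omega>
  proof -
    have "\<sigma> \<omega> \<le> ennreal t \<longleftrightarrow> X_path \<omega> \<in> A t" for t using A(2)[of t] that by auto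
    then show ?thesis by (simp add: \<tau>_def grid_time_def)
  qed
  have T_in: "?T \<omega> \<in> time_grid m" for \<omega> using grid_time_in by blast
  have TA: "{\<omega> \<in> space M. ?T \<omega> = t} \<in> sets (FX (ennreal t))" for t
  proof -
    have "{\<omega> \<in> space M. ?T \<omega> = t} = X_path -` {x. \<tau> x = t} \<inter> space M" using T by auto
    with decision_rulesD(3)[OF r, of t] show ?thesis unfolding sets_FX by blast
  qed
  have PB: "{\<omega> \<in> space M. Post \<pi> t \<omega> $ i > 1/2} \<in> sets (FX (ennreal t))" if "t \<in> time_grid m" for t i
  proof -
    have "0 \<le> t" using time_grid(3)[of m] that by auto
    from B(1)[of t i] B(2)[OF this, of i] show ?thesis unfolding sets_FX by blast
  qed
  have "(\<integral>\<^sup>+\<omega>. ennreal (\<Sum>i\<in>UNIV. of_bool (?D (X_path \<omega>) i \<noteq> (Y i \<omega> = 1))) \<partial>P \<pi>)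
    = (\<integral>\<^sup>+\<omega>. ennreal (\<Sum>i\<in>UNIV. of_bool ((\<omega> \<in> {\<omega>' \<in> space M. Post \<pi> (?T \<omega>) \<omega>' $ i > 1/2}) \<noteq> (Y i \<omega> = 1))) \<partial>P \<pi>)"
  proof (intro nn_integral_cong arg_cong[where f=ennreal] sum.cong refl)
    fix \<omega> i assume "\<omega> \<in> space (P \<pi>)"
    then have "\<omega> \<in> space M" by (simp add: space_P[OF \<pi>])
    then have "X_path \<omega> \<in> B (?T \<omega>) i \<longleftrightarrow> \<omega> \<in> {\<omega>' \<in> space M. Post \<pi> (?T \<omega>) \<omega>' $ i > 1/2}"
      by (subst B(2)[OF grid_time_nonneg]) auto
    then show "of_bool (?D (X_path \<omega>) i \<noteq> (Y i \<omega> = 1)) =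
      (of_bool ((\<omega> \<in> {\<omega>' \<in> space M. Post \<pi> (?T \<omega>) \<omega>' $ i > 1/2}) \<noteq> (Y i \<omega> = 1)) :: real)"
      by (simp only: T[OF \<open>\<omega> \<in> space M\<close>])
  qed
  also have "\<dots> = (\<integral>\<^sup>+\<omega>. ennreal (g (Post \<pi> (?T \<omega>) \<omega>)) \<partial>P \<pi>)"
    by (rule stopped_decision(2)[OF \<pi> time_grid(1,3) T_in TA PB, symmetric]) auto
  finally have "bayes_risk \<mu> \<nu> c (\<tau>, ?D) \<pi> = (\<integral>\<^sup>+\<omega>. ennreal (g (Post \<pi> (?T \<omega>) \<omega>)) \<partial>P \<pi>) +
      (\<integral>\<^sup>+\<omega>. ennreal c * ennreal (\<tau> (X_path \<omega>)) \<partial>P \<pi>)"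
    unfolding bayes_risk_split(1)[OF \<pi> r c] by simp
  also have "(\<integral>\<^sup>+\<omega>. ennreal c * ennreal (\<tau> (X_path \<omega>)) \<partial>P \<pi>) = (\<integral>\<^sup>+\<omega>. ennreal c * ennreal (?T \<omega>) \<partial>P \<pi>)"
    by (intro nn_integral_cong) (simp add: T space_P[OF \<pi>])
  finally show "\<exists>r\<in>decision_rules. bayes_risk \<mu> \<nu> c r \<pi> =
      (\<integral>\<^sup>+\<omega>. ennreal (g (Post \<pi> (grid_time m (\<sigma> \<omega>)) \<omega>)) \<partial>P \<pi>) +
      (\<integral>\<^sup>+\<omega>. ennreal c * ennreal (grid_time m (\<sigma> \<omega>)) \<partial>P \<pi>)"
    using r by blast
  show "(\<lambda>\<omega>. g (Post \<pi> (?T \<omega>) \<omega>)) \<in> borel_measurable (P \<pi>)"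
  proof (rule measurable_compose_countable'[where I="time_grid m" and g="?T"])
    show "?T \<in> P \<pi> \<rightarrow>\<^sub>M count_space (time_grid m)"
      unfolding measurable_count_space_eq2[OF time_grid(1)]
    proof (intro conjI ballI)
      fix t
      have "?T -` {t} \<inter> space (P \<pi>) = {\<omega> \<in> space M. ?T \<omega> = t}" by (auto simp: space_P[OF \<pi>])
      then show "?T -` {t} \<inter> space (P \<pi>) \<in> sets (P \<pi>)" using FX_set_in_P[OF \<pi> TA[of t]] by simp
    qed (use T_in in auto)
    show "countable (time_grid m)" using time_grid(1) by (rule countable_finite)
    fix t assume "t \<in> time_grid m"
    then have "0 \<le> t" using time_grid(3) by auto
    then show "(\<lambda>\<omega>. g (Post \<pi> t \<omega>)) \<in> borel_measurable (P \<pi>)" by (rule g_Post_measurable[OF \<pi>])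
  qed
qed

text \<open>Converse of the bound by rules. Along the grid times the terminal costs converge, by
  continuity of the posterior and dominated convergence, and the running cost exceeds that of
  \<open>\<sigma>\<close> by at most \<open>c/(m+1)\<close>.\<close>

lemma le_V_if_le_bayes_risk:
  assumes \<pi>: "\<pi> \<in> cbox 0 1" and c: "0 \<le> c"
    and b: "\<And>r. r \<in> decision_rules \<Longrightarrow> b \<le> bayes_risk \<mu> \<nu> c r \<pi>"
  shows "b \<le> V c \<pi>"
  unfolding V_def
proof (rule INF_greatest, clarify)
  fix \<sigma> assume \<sigma>: "stopping_time FX \<sigma>" and fin: "AE \<omega> in P \<pi>. \<sigma> \<omega> < \<infinity>"
  interpret prob_space "P \<pi>" by (rule prob_space_P) fact
  have \<sigma>m[measurable]: "\<sigma> \<in> borel_measurable (P \<pi>)" by (rule stopping_time_measurable[OF \<pi> \<sigma>])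
  let ?T = "\<lambda>m \<omega>. grid_time m (\<sigma> \<omega>)"
  \<comment> \<open>Where \<open>\<sigma>\<close> is infinite the grid times run off to infinity and
    the posterior has no prescribed limit. The value 0 there gives convergence at every point, hence
    a measurable limit; the event is null, so no integral changes.\<close>
  define u where "u m \<omega> = (if \<sigma> \<omega> < \<infinity> then g (Post \<pi> (?T m \<omega>) \<omega>) else 0)" for m \<omega>
  define u' where "u' \<omega> = (if \<sigma> \<omega> < \<infinity> then g (Post \<pi> (enn2real (\<sigma> \<omega>)) \<omega>) else 0)" for \<omega>
  have um [measurable]: "u m \<in> borel_measurable (P \<pi>)" for m
  proof -
    note [measurable] = grid_rule(2)[OF \<pi> \<sigma> c]
    show ?thesis unfolding u_def by measurable
  qed
  have lim: "(\<lambda>m. u m \<omega>) \<longlonglongrightarrow> u' \<omega>" if "\<omega> \<in> space (P \<pi>)" for \<omega>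
    unfolding u_def u'_def using that
    by (auto simp: space_P[OF \<pi>] intro!: g_Post_tendsto[OF \<pi>] grid_time_tendsto grid_time_nonneg)
  have u'm [measurable]: "u' \<in> borel_measurable (P \<pi>)"
    using lim um by (rule borel_measurable_LIMSEQ_real)
  have "(\<lambda>m. \<integral>\<^sup>+\<omega>. ennreal (u m \<omega>) \<partial>P \<pi>) \<longlonglongrightarrow> (\<integral>\<^sup>+\<omega>. ennreal (u' \<omega>) \<partial>P \<pi>)"
  proof (rule nn_integral_dominated_convergence[where w="\<lambda>_. ennreal (real CARD('n))"])
    show "AE \<omega> in P \<pi>. ennreal (u m \<omega>) \<le> ennreal (real CARD('n))" for m
      by (intro AE_I2 ennreal_leI) (simp add: u_def g_le_card)
    show "AE \<omega> in P \<pi>. (\<lambda>m. ennreal (u m \<omega>)) \<longlonglongrightarrow> ennreal (u' \<omega>)"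
      by (intro AE_I2 tendsto_ennrealI lim)
  qed (simp_all add: emeasure_space_1)
  moreover have "(\<lambda>m. (\<integral>\<^sup>+\<omega>. ennreal c * \<sigma> \<omega> \<partial>P \<pi>) + ennreal (c * (1 / real (Suc m))))
      \<longlonglongrightarrow> (\<integral>\<^sup>+\<omega>. ennreal c * \<sigma> \<omega> \<partial>P \<pi>) + ennreal (c * 0)"
    using LIMSEQ_inverse_real_of_nat
    by (intro tendsto_intros tendsto_ennrealI) (simp_all add: inverse_eq_divide)
  ultimately have "(\<lambda>m. (\<integral>\<^sup>+\<omega>. ennreal (u m \<omega>) \<partial>P \<pi>) + ((\<integral>\<^sup>+\<omega>. ennreal c * \<sigma> \<omega> \<partial>P \<pi>) + ennreal (c * (1 / real (Suc m)))))
     \<longlonglongrightarrow> (\<integral>\<^sup>+\<omega>. ennreal (u' \<omega>) \<partial>P \<pi>) + ((\<integral>\<^sup>+\<omega>. ennreal c * \<sigma> \<omega> \<partial>P \<pi>) + ennreal (c * 0))"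
    by (rule tendsto_add)
  then have "b \<le> (\<integral>\<^sup>+\<omega>. ennreal (u' \<omega>) \<partial>P \<pi>) + ((\<integral>\<^sup>+\<omega>. ennreal c * \<sigma> \<omega> \<partial>P \<pi>) + ennreal (c * 0))"
  proof (rule LIMSEQ_le_const, intro exI allI impI)
    fix m :: nat
    obtain r where r: "r \<in> decision_rules" "bayes_risk \<mu> \<nu> c r \<pi> =
      (\<integral>\<^sup>+\<omega>. ennreal (g (Post \<pi> (?T m \<omega>) \<omega>)) \<partial>P \<pi>) +
      (\<integral>\<^sup>+\<omega>. ennreal c * ennreal (?T m \<omega>) \<partial>P \<pi>)"
      using grid_rule(1)[OF \<pi> \<sigma> c, of m] by blast
    have "(\<integral>\<^sup>+\<omega>. ennreal (g (Post \<pi> (?T m \<omega>) \<omega>)) \<partial>P \<pi>) = (\<integral>\<^sup>+\<omega>. ennreal (u m \<omega>) \<partial>P \<pi>)"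
      using fin by (intro nn_integral_cong_AE, eventually_elim) (simp add: u_def)
    moreover have "(\<integral>\<^sup>+\<omega>. ennreal c * ennreal (?T m \<omega>) \<partial>P \<pi>)
        \<le> (\<integral>\<^sup>+\<omega>. ennreal c * \<sigma> \<omega> + ennreal (c * (1 / real (Suc m))) \<partial>P \<pi>)"
    proof (rule nn_integral_mono)
      fix \<omega>
      have "ennreal c * ennreal (?T m \<omega>) \<le> ennreal c * (\<sigma> \<omega> + ennreal (1 / real (Suc m)))"
        by (intro mult_left_mono ennreal_grid_time_le) simp
      also have "\<dots> = ennreal c * \<sigma> \<omega> + ennreal (c * (1 / real (Suc m)))"
        by (subst ennreal_mult[OF c]) (auto simp: distrib_left)
      finally show "ennreal c * ennreal (?T m \<omega>) \<le> ennreal c * \<sigma> \<omega> + ennreal (c * (1 / real (Suc m)))" .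
    qed
    moreover have "(\<integral>\<^sup>+\<omega>. ennreal c * \<sigma> \<omega> + ennreal (c * (1 / real (Suc m))) \<partial>P \<pi>)
        = (\<integral>\<^sup>+\<omega>. ennreal c * \<sigma> \<omega> \<partial>P \<pi>) + ennreal (c * (1 / real (Suc m)))"
      by (subst nn_integral_add) (auto simp: emeasure_space_1)
    ultimately show "b \<le> (\<integral>\<^sup>+\<omega>. ennreal (u m \<omega>) \<partial>P \<pi>) + ((\<integral>\<^sup>+\<omega>. ennreal c * \<sigma> \<omega> \<partial>P \<pi>) + ennreal (c * (1 / real (Suc m))))"
      using b[OF r(1)] unfolding r(2) by (metis (no_types, lifting) add_left_mono order_trans)
  qed
  also have "\<dots> = (\<integral>\<^sup>+\<omega>. ennreal (u' \<omega>) + ennreal c * \<sigma> \<omega> \<partial>P \<pi>)"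
    by (simp add: nn_integral_add)
  also have "\<dots> = (\<integral>\<^sup>+\<omega>. ennreal (g (Post \<pi> (enn2real (\<sigma> \<omega>)) \<omega>)) + ennreal c * \<sigma> \<omega> \<partial>P \<pi>)"
    using fin by (intro nn_integral_cong_AE, eventually_elim) (simp add: u'_def)
  finally show "b \<le> (\<integral>\<^sup>+\<omega>. ennreal (g (Post \<pi> (enn2real (\<sigma> \<omega>)) \<omega>)) + ennreal c * \<sigma> \<omega> \<partial>P \<pi>)" .
qed

end

section \<open>Comparison with the one-dimensional problems\<close>

text \<open>With \<open>i\<close> a parameter, one argument covers both channels: \<open>a\<close>
  belongs to the active channel \<open>i\<close>, and \<open>b\<close> to the other one.\<close>

definition combine :: "2 \<Rightarrow> 'a \<Rightarrow> 'a \<Rightarrow> 2 \<Rightarrow> 'a" where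
  "combine i a b = (\<lambda>k. if k = i then a else b)"

text \<open>The other channel is ignored and its hypothesis declared false. The expected error there
  is its prior probability, which below 1/2 is its share of \<open>g\<close>.\<close>

definition lift_rule :: "2 \<Rightarrow> ((1 \<Rightarrow> real \<Rightarrow> real) \<Rightarrow> real) \<times> ((1 \<Rightarrow> real \<Rightarrow> real) \<Rightarrow> 1 \<Rightarrow> bool)
    \<Rightarrow> ((2 \<Rightarrow> real \<Rightarrow> real) \<Rightarrow> real) \<times> ((2 \<Rightarrow> real \<Rightarrow> real) \<Rightarrow> 2 \<Rightarrow> bool)" where
  "lift_rule i r = (\<lambda>x. fst r (\<lambda>_. x i), \<lambda>x k. k = i \<and> snd r (\<lambda>_. x i) 1)"

definition slice_rule :: "2 \<Rightarrow> (real \<Rightarrow> real)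
    \<Rightarrow> ((2 \<Rightarrow> real \<Rightarrow> real) \<Rightarrow> real) \<times> ((2 \<Rightarrow> real \<Rightarrow> real) \<Rightarrow> 2 \<Rightarrow> bool)
    \<Rightarrow> ((1 \<Rightarrow> real \<Rightarrow> real) \<Rightarrow> real) \<times> ((1 \<Rightarrow> real \<Rightarrow> real) \<Rightarrow> 1 \<Rightarrow> bool)" where
  "slice_rule i b r = (\<lambda>x. fst r (combine i (x 1) b), \<lambda>x _. snd r (combine i (x 1) b) i)"

text \<open>A path map that never looks ahead preserves rules. Suppressing verdicts by
  \<open>Q\<close> and relabelling them by \<open>h\<close> covers both lifting to two channels and
  slicing down to one.\<close>

lemma decision_rules_compose:
  assumes r: "r \<in> decision_rules"
    and f: "\<And>t. f \<in> canonical_filtration t \<rightarrow>\<^sub>M canonical_filtration t"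
  shows "(\<lambda>x. fst r (f x), \<lambda>x k. Q k \<and> snd r (f x) (h k)) \<in> decision_rules"
proof -
  obtain \<tau> D where r': "r = (\<tau>, D)" by (cases r)
  note D = decision_rulesD[OF r[unfolded r']]
  have "{x. \<tau> (f x) = t} \<in> sets (canonical_filtration (ennreal t))" for t
    using measurable_sets[OF f D(3)[of t]] by (simp add: vimage_def)
  moreover have "{x. \<tau> (f x) = t \<and> Q k \<and> D (f x) (h k)} \<in> sets (canonical_filtration (ennreal t))" for t k
    using measurable_sets[OF f D(4)[of t "h k"]] by (cases "Q k") (simp_all add: vimage_def)
  moreover have "finite (range (\<lambda>x. \<tau> (f x)))"
    using D(1) by (rule finite_subset[rotated]) auto
  ultimately show ?thesis by (simp add: decision_rules_def r' D(2))
qed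

lemma lift_rule: "r \<in> decision_rules \<Longrightarrow> lift_rule i r \<in> decision_rules"
  unfolding lift_rule_def
  by (rule decision_rules_compose)
     (auto intro!: measurable_canonical_filtrationI canonical_filtration_eval)

lemma slice_rule:
  assumes "r \<in> decision_rules" shows "slice_rule i b r \<in> decision_rules"
proof -
  have "(\<lambda>x. combine i (x 1) b) \<in> canonical_filtration t \<rightarrow>\<^sub>M canonical_filtration t" for t
  proof (rule measurable_canonical_filtrationI)
    fix k s assume "0 \<le> s" "ennreal s \<le> t"
    then show "(\<lambda>x. combine i (x 1) b k s) \<in> borel_measurable (canonical_filtration t)"
      by (cases "k = i") (simp_all add: combine_def canonical_filtration_eval)
  qed
  from decision_rules_compose[OF assms this, where Q="\<lambda>_. True" and h="\<lambda>_. i"]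
  show ?thesis by (simp add: slice_rule_def)
qed

lemma UNIV_2_pair:
  assumes "i \<noteq> (j :: 2)" shows "UNIV = {i, j}"
  using assms exhaust_2[of i] exhaust_2[of j] by (auto simp: UNIV_2)

lemma sum_2_pair: "i \<noteq> (j :: 2) \<Longrightarrow> sum f UNIV = f i + f j"
  by (simp add: UNIV_2_pair)

lemma prod_2_pair: "i \<noteq> (j :: 2) \<Longrightarrow> prod f UNIV = f i * f j"
  by (simp add: UNIV_2_pair)

lemma combine_apply: "combine i a b i = a" "i \<noteq> j \<Longrightarrow> combine i a b j = b"
  by (auto simp: combine_def)

lemma combine_eta: "i \<noteq> j \<Longrightarrow> combine i (x i) (x j) = x"
  using UNIV_2_pair[of i j] by (auto simp: combine_def fun_eq_iff)

lemma UNIV_1_bool: "(UNIV :: (1 \<Rightarrow> bool) set) = {\<lambda>_. True, \<lambda>_. False}"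
  by (auto simp: fun_eq_iff)

lemma UNIV_2_bool:
  "(UNIV :: (2 \<Rightarrow> bool) set) =
    {combine i True True, combine i True False, combine i False True, combine i False False}"
proof -
  have "y \<in> {combine i True True, combine i True False, combine i False True, combine i False False}" for y
  proof -
    obtain j where j: "i \<noteq> j" using zero_neq_one[where 'a=2] by metis
    show ?thesis using combine_eta[OF j, of y] by (cases "y i"; cases "y j") auto
  qed
  then show ?thesis by auto
qed

lemma combine_eq_iff: "combine i a b = combine i a' b' \<longleftrightarrow> a = a' \<and> b = b'"
proof -
  obtain j where j: "i \<noteq> j" using zero_neq_one[where 'a=2] by metis
  show ?thesis using combine_apply(1)[of i] combine_apply(2)[OF j] by metis
qed

lemma bayes_risk_1:
  "bayes_risk \<mu> \<nu> c r (vec p) = ennreal p * risk \<mu> \<nu> c r (\<lambda>_::1. True) + ennreal (1 - p) * risk \<mu> \<nu> c r (\<lambda>_. False)"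
proof -
  have "(\<lambda>_::1. True) \<noteq> (\<lambda>_. False)" by (simp add: fun_eq_iff)
  then show ?thesis unfolding bayes_risk_def UNIV_1_bool by (simp add: prior_weight_def)
qed

lemma bayes_risk_2:
  assumes "i \<noteq> j"
  shows "bayes_risk \<mu> \<nu> c r \<pi> =
    ennreal (\<pi> $ i * \<pi> $ j) * risk \<mu> \<nu> c r (combine i True True) +
    ennreal (\<pi> $ i * (1 - \<pi> $ j)) * risk \<mu> \<nu> c r (combine i True False) +
    ennreal ((1 - \<pi> $ i) * \<pi> $ j) * risk \<mu> \<nu> c r (combine i False True) +
    ennreal ((1 - \<pi> $ i) * (1 - \<pi> $ j)) * risk \<mu> \<nu> c r (combine i False False)"
  unfolding bayes_risk_def UNIV_2_bool[of i] using assms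
  by (simp add: combine_eq_iff prior_weight_def prod_2_pair[OF assms] combine_apply add.assoc)

section \<open>Noise integrals in two channels and in one\<close>

lemma measurable_combine:
  assumes [measurable_cong]: "sets \<nu> = sets path_space"
  shows "(\<lambda>(b, a). combine i a b) \<in> \<nu> \<Otimes>\<^sub>M \<nu> \<rightarrow>\<^sub>M PiM UNIV (\<lambda>_. path_space)"
proof (rule measurable_PiM_single')
  fix k :: 2
  show "(\<lambda>\<omega>. (case \<omega> of (b, a) \<Rightarrow> combine i a b) k) \<in> \<nu> \<Otimes>\<^sub>M \<nu> \<rightarrow>\<^sub>M path_space"
    by (cases "k = i") (simp_all add: combine_def case_prod_beta)
qed (auto simp: space_PiM)

text \<open>The path of the other channel comes first in the pair, so that Tonelli puts the integral
  over the active channel inside, where it is a one-dimensional risk.\<close>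

lemma noise_2_eq_distr:
  assumes "prob_space \<nu>" and [measurable_cong]: "sets \<nu> = sets path_space"
  shows "distr (\<nu> \<Otimes>\<^sub>M \<nu>) (PiM UNIV (\<lambda>_. path_space)) (\<lambda>(b, a). combine i a b) = PiM UNIV (\<lambda>_. \<nu>)"
proof -
  interpret prob_space \<nu> by fact
  interpret product_sigma_finite "\<lambda>_::2. \<nu>" ..
  have sp: "space \<nu> = UNIV" using sets_eq_imp_space_eq[OF assms(2)] by simp
  obtain j where j: "i \<noteq> j" using zero_neq_one[where 'a=2] by metis
  show ?thesis
  proof (rule PiM_eqI)
    fix A :: "2 \<Rightarrow> (real \<Rightarrow> real) set" assume A: "\<And>k. k \<in> UNIV \<Longrightarrow> A k \<in> sets \<nu>"
    have "emeasure (distr (\<nu> \<Otimes>\<^sub>M \<nu>) (PiM UNIV (\<lambda>_. path_space)) (\<lambda>(b, a). combine i a b)) (Pi\<^sub>E UNIV A)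
      = emeasure (\<nu> \<Otimes>\<^sub>M \<nu>) ((\<lambda>(b, a). combine i a b) -` Pi\<^sub>E UNIV A \<inter> space (\<nu> \<Otimes>\<^sub>M \<nu>))"
      using A assms(2) by (intro emeasure_distr measurable_combine sets_PiM_I_finite) auto
    also have "(\<lambda>(b, a). combine i a b) -` Pi\<^sub>E UNIV A \<inter> space (\<nu> \<Otimes>\<^sub>M \<nu>) = A j \<times> A i"
    proof -
      have "combine i a b \<in> Pi\<^sub>E UNIV A \<longleftrightarrow> (\<forall>k\<in>UNIV. combine i a b k \<in> A k)" for a b
        by (simp add: PiE_iff)
      then have "combine i a b \<in> Pi\<^sub>E UNIV A \<longleftrightarrow> b \<in> A j \<and> a \<in> A i" for a b
        unfolding UNIV_2_pair[OF j] by (auto simp: combine_apply combine_apply(2)[OF j])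
      then show ?thesis by (auto simp: sp space_pair_measure)
    qed
    also have "emeasure (\<nu> \<Otimes>\<^sub>M \<nu>) (A j \<times> A i) = (\<Prod>k\<in>UNIV. emeasure \<nu> (A k))"
      using A by (simp add: emeasure_pair_measure_Times prod_2_pair[OF j] mult.commute)
    finally show "emeasure (distr (\<nu> \<Otimes>\<^sub>M \<nu>) (PiM UNIV (\<lambda>_. path_space)) (\<lambda>(b, a). combine i a b)) (Pi\<^sub>E UNIV A)
      = (\<Prod>k\<in>UNIV. emeasure \<nu> (A k))" .
  qed (auto intro!: sets_PiM_cong simp: assms(2))
qed

lemma nn_integral_noise_2:
  assumes \<nu>: "prob_space \<nu>" "sets \<nu> = sets path_space"
    and f: "f \<in> borel_measurable (PiM UNIV (\<lambda>_. path_space))"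
  shows "(\<integral>\<^sup>+w. f w \<partial>PiM UNIV (\<lambda>_. \<nu>)) = (\<integral>\<^sup>+b. \<integral>\<^sup>+a. f (combine i a b) \<partial>\<nu> \<partial>\<nu>)"
proof -
  interpret prob_space \<nu> by fact
  have "(\<integral>\<^sup>+w. f w \<partial>PiM UNIV (\<lambda>_. \<nu>)) = (\<integral>\<^sup>+z. f (case z of (b, a) \<Rightarrow> combine i a b) \<partial>(\<nu> \<Otimes>\<^sub>M \<nu>))"
    unfolding noise_2_eq_distr[OF \<nu>, of i, symmetric]
    by (rule nn_integral_distr[OF measurable_combine[OF \<nu>(2)]]) (use f in simp)
  also have "\<dots> = (\<integral>\<^sup>+b. \<integral>\<^sup>+a. f (combine i a b) \<partial>\<nu> \<partial>\<nu>)"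
    by (subst nn_integral_fst[symmetric]) (auto intro: measurable_compose[OF measurable_combine[OF \<nu>(2)] f])
  finally show ?thesis .
qed

lemma nn_integral_noise_1:
  assumes \<nu>: "prob_space \<nu>" "sets \<nu> = sets path_space"
    and f: "f \<in> borel_measurable (PiM UNIV (\<lambda>_. path_space))"
  shows "(\<integral>\<^sup>+w. f w \<partial>PiM UNIV (\<lambda>_::1. \<nu>)) = (\<integral>\<^sup>+a. f (\<lambda>_. a) \<partial>\<nu>)"
proof -
  interpret prob_space \<nu> by fact
  interpret product_sigma_finite "\<lambda>_::1. \<nu>" ..
  have sp: "space \<nu> = UNIV" using sets_eq_imp_space_eq[OF \<nu>(2)] by simp
  have m: "(\<lambda>a _. a) \<in> \<nu> \<rightarrow>\<^sub>M PiM UNIV (\<lambda>_::1. path_space)"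
    by (rule measurable_PiM_single') (auto simp: measurable_cong_sets[OF \<nu>(2) refl] space_PiM)
  have law: "distr \<nu> (PiM UNIV (\<lambda>_::1. path_space)) (\<lambda>a _. a) = PiM UNIV (\<lambda>_. \<nu>)"
  proof (rule PiM_eqI)
    fix A :: "1 \<Rightarrow> (real \<Rightarrow> real) set" assume A: "\<And>k. k \<in> UNIV \<Longrightarrow> A k \<in> sets \<nu>"
    have "emeasure (distr \<nu> (PiM UNIV (\<lambda>_::1. path_space)) (\<lambda>a _. a)) (Pi\<^sub>E UNIV A)
      = emeasure \<nu> ((\<lambda>a _. a) -` Pi\<^sub>E UNIV A \<inter> space \<nu>)"
      using A \<nu>(2) by (intro emeasure_distr m sets_PiM_I_finite) auto
    also have "(\<lambda>a _. a) -` Pi\<^sub>E UNIV A \<inter> space \<nu> = A 1"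
      by (auto simp: sp PiE_iff)
    finally show "emeasure (distr \<nu> (PiM UNIV (\<lambda>_::1. path_space)) (\<lambda>a _. a)) (Pi\<^sub>E UNIV A)
      = (\<Prod>k\<in>UNIV. emeasure \<nu> (A k))" by simp
  qed (auto intro!: sets_PiM_cong simp: \<nu>(2))
  show ?thesis unfolding law[symmetric] by (rule nn_integral_distr[OF m]) (use f in simp)
qed

lemma drift_component: "(\<lambda>_. drift \<mu> y w i) = drift (vec (\<mu> $ i)) (\<lambda>_::1. y i) (\<lambda>_. w i)"
  by (simp add: drift_def fun_eq_iff)

text \<open>A false hypothesis contributes no drift, so channel \<open>j\<close> shows its raw noise
  \<open>b\<close>.\<close>

lemma drift_inactive:
  assumes "i \<noteq> j" "\<not> y j"
  shows "drift \<mu> y (combine i a b) = combine i (drift (vec (\<mu> $ i)) (\<lambda>_::1. y i) (\<lambda>_. a) 1) b"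
  using assms UNIV_2_pair[OF assms(1)] by (auto simp: drift_def fun_eq_iff combine_def)

lemma risk_1:
  assumes \<nu>: "prob_space \<nu>" "sets \<nu> = sets path_space" and r: "r \<in> decision_rules"
  shows "risk \<mu> \<nu> c r y = (\<integral>\<^sup>+a. ennreal (loss c r y (drift \<mu> y (\<lambda>_::1. a))) \<partial>\<nu>)"
  unfolding risk_def
  by (rule nn_integral_noise_1[OF \<nu>]) (intro measurable_compose[OF _ measurable_ennreal] loss_drift_measurable r)

text \<open>The loss separates: channel \<open>i\<close> incurs the one-dimensional loss, and
  channel \<open>j\<close> one error exactly when its hypothesis is true.\<close>

lemma risk_lift_rule:
  assumes \<nu>: "prob_space \<nu>" "sets \<nu> = sets path_space" and r: "r \<in> decision_rules"
    and ij: "i \<noteq> j" and c: "0 \<le> c"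
  shows "risk \<mu> \<nu> c (lift_rule i r) y = risk (vec (\<mu> $ i)) \<nu> c r (\<lambda>_. y i) + ennreal (of_bool (y j))"
proof -
  interpret prob_space \<nu> by fact
  have nonneg: "0 \<le> fst r x" for x using r decision_rulesD(2)[of "fst r" "snd r"] by simp
  have loss: "loss c (lift_rule i r) y x = loss c r (\<lambda>_. y i) (\<lambda>_. x i) + of_bool (y j)" for x
    using ij by (simp add: loss_def lift_rule_def sum_2_pair[OF ij])
  have loss_nonneg: "0 \<le> loss c r (\<lambda>_. y i) x" for x
    using c nonneg by (simp add: loss_def sum_nonneg)
  have "risk \<mu> \<nu> c (lift_rule i r) y = (\<integral>\<^sup>+b. \<integral>\<^sup>+a. ennreal (loss c (lift_rule i r) y (drift \<mu> y (combine i a b))) \<partial>\<nu> \<partial>\<nu>)"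
    unfolding risk_def
    by (rule nn_integral_noise_2[OF \<nu>])
       (intro measurable_compose[OF _ measurable_ennreal] loss_drift_measurable lift_rule r)
  also have "\<dots> = (\<integral>\<^sup>+b. \<integral>\<^sup>+a. ennreal (loss c r (\<lambda>_. y i) (drift (vec (\<mu> $ i)) (\<lambda>_. y i) (\<lambda>_. a))) + ennreal (of_bool (y j)) \<partial>\<nu> \<partial>\<nu>)"
    by (intro nn_integral_cong, subst loss, subst ennreal_plus)
       (simp_all add: loss_nonneg drift_component combine_apply)
  also have "\<dots> = (\<integral>\<^sup>+b. risk (vec (\<mu> $ i)) \<nu> c r (\<lambda>_. y i) + ennreal (of_bool (y j)) \<partial>\<nu>)"
  proof (rule nn_integral_cong)
    fix b
    have m: "(\<lambda>a _. a) \<in> \<nu> \<rightarrow>\<^sub>M PiM UNIV (\<lambda>_::1. path_space)"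
      by (rule measurable_PiM_single') (auto simp: measurable_cong_sets[OF \<nu>(2) refl] space_PiM)
    have "(\<lambda>a. ennreal (loss c r (\<lambda>_. y i) (drift (vec (\<mu> $ i)) (\<lambda>_. y i) (\<lambda>_. a)))) \<in> borel_measurable \<nu>"
      by (intro measurable_compose[OF _ measurable_ennreal] measurable_compose[OF m loss_drift_measurable] r)
    then show "(\<integral>\<^sup>+a. ennreal (loss c r (\<lambda>_. y i) (drift (vec (\<mu> $ i)) (\<lambda>_. y i) (\<lambda>_. a))) + ennreal (of_bool (y j)) \<partial>\<nu>)
      = risk (vec (\<mu> $ i)) \<nu> c r (\<lambda>_. y i) + ennreal (of_bool (y j))"
      by (subst nn_integral_add) (simp_all add: risk_1[OF \<nu> r] emeasure_space_1)
  qed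
  also have "\<dots> = risk (vec (\<mu> $ i)) \<nu> c r (\<lambda>_. y i) + ennreal (of_bool (y j))"
    by (simp add: emeasure_space_1)
  finally show ?thesis .
qed

text \<open>Averaged over the prior, the extra error of channel \<open>j\<close> is
  \<open>\<pi> $ j\<close>. Risks are finite, so the algebra can be done with the real numbers
  \<open>R y\<close>.\<close>

lemma bayes_risk_lift_rule:
  assumes \<nu>: "prob_space \<nu>" "sets \<nu> = sets path_space" and r: "r \<in> decision_rules"
    and ij: "i \<noteq> j" and c: "0 \<le> c" and \<pi>: "\<pi> \<in> cbox 0 1"
  shows "bayes_risk \<mu> \<nu> c (lift_rule i r) \<pi> = bayes_risk (vec (\<mu> $ i)) \<nu> c r (vec (\<pi> $ i)) + ennreal (\<pi> $ j)"
proof -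
  have 01: "0 \<le> \<pi> $ k" "\<pi> $ k \<le> 1" for k using \<pi> by (auto simp: mem_box_cart)
  define R where "R y = enn2real (risk (vec (\<mu> $ i)) \<nu> c r y)" for y
  have R: "risk (vec (\<mu> $ i)) \<nu> c r y = ennreal (R y)" for y
    using risk_finite[OF r c \<nu>(1)] by (simp add: R_def)
  have R0: "0 \<le> R y" for y by (simp add: R_def)
  let ?p = "\<pi> $ i" and ?q = "\<pi> $ j"
  have "bayes_risk \<mu> \<nu> c (lift_rule i r) \<pi> =
     ennreal (?p * ?q * (R (\<lambda>_. True) + 1) + ?p * (1 - ?q) * R (\<lambda>_. True) +
       (1 - ?p) * ?q * (R (\<lambda>_. False) + 1) + (1 - ?p) * (1 - ?q) * R (\<lambda>_. False))"
    unfolding bayes_risk_2[OF ij] risk_lift_rule[OF \<nu> r ij c] R combine_apply(1) combine_apply(2)[OF ij]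
    using 01 R0 by (simp add: ennreal_mult ennreal_plus)
  also have "\<dots> = ennreal (?p * R (\<lambda>_. True) + (1 - ?p) * R (\<lambda>_. False) + ?q)"
    by (simp add: algebra_simps)
  also have "\<dots> = bayes_risk (vec (\<mu> $ i)) \<nu> c r (vec ?p) + ennreal ?q"
    unfolding bayes_risk_1 R using 01 R0 by (simp add: ennreal_mult ennreal_plus)
  finally show ?thesis .
qed

text \<open>When \<open>\<pi>\<^sub>j = 0\<close> the second observation is pure noise: freezing its path turns a
  two-dimensional rule into a one-dimensional one, so the noise acts as mere randomisation.\<close>

lemma le_bayes_risk_if_inactive:
  assumes \<nu>: "prob_space \<nu>" "sets \<nu> = sets path_space" and r: "r \<in> decision_rules"
    and ij: "(i :: 2) \<noteq> j" and c: "0 \<le> c" and \<pi>: "\<pi> \<in> cbox 0 1" and "\<pi> $ j = 0"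
    and v: "\<And>r'. r' \<in> decision_rules \<Longrightarrow> v \<le> bayes_risk (vec (\<mu> $ i) :: real ^ 1) \<nu> c r' (vec (\<pi> $ i))"
  shows "v \<le> bayes_risk \<mu> \<nu> c r \<pi>"
proof -
  interpret prob_space \<nu> by fact
  note [measurable_cong] = \<nu>(2)
  obtain \<tau> D where r': "r = (\<tau>, D)" by (cases r)
  let ?l = "\<lambda>p b a. ennreal (loss c (slice_rule i b r) (\<lambda>_. p) (drift (vec (\<mu> $ i)) (\<lambda>_. p) (\<lambda>_. a)))"
  let ?risk = "\<lambda>b p. risk (vec (\<mu> $ i)) \<nu> c (slice_rule i b r) (\<lambda>_. p)"
  have l_meas: "(\<lambda>(b, a). ?l p b a) \<in> borel_measurable (\<nu> \<Otimes>\<^sub>M \<nu>)" for p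
  proof -
    have f: "(\<lambda>(b, a). combine i (drift (vec (\<mu> $ i)) (\<lambda>_::1. p) (\<lambda>_. a) 1) b)
        \<in> \<nu> \<Otimes>\<^sub>M \<nu> \<rightarrow>\<^sub>M canonical_filtration top"
    proof (rule measurable_canonical_filtrationI)
      fix k and s :: real assume s: "0 \<le> s"
      have "(\<lambda>x. x s) \<in> borel_measurable \<nu>"
        using measurable_path_space_eval[OF s] by (simp add: measurable_cong_sets[OF \<nu>(2) refl])
      note [measurable] = measurable_compose[OF measurable_fst this] measurable_compose[OF measurable_snd this]
      show "(\<lambda>z. (case z of (b, a) \<Rightarrow> combine i (drift (vec (\<mu> $ i)) (\<lambda>_::1. p) (\<lambda>_. a) 1) b) k s)
          \<in> borel_measurable (\<nu> \<Otimes>\<^sub>M \<nu>)"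
        by (cases "k = i") (simp_all add: combine_def drift_def case_prod_beta)
    qed
    note [measurable] = measurable_compose[OF f decision_rules_measurable(1)[OF r[unfolded r']]]
      measurable_compose[OF f decision_rules_measurable(2)[OF r[unfolded r']]]
    have "(\<lambda>z. ennreal (of_bool (D (case z of (b, a) \<Rightarrow> combine i (drift (vec (\<mu> $ i)) (\<lambda>_::1. p) (\<lambda>_. a) 1) b) i \<noteq> p)
        + c * \<tau> (case z of (b, a) \<Rightarrow> combine i (drift (vec (\<mu> $ i)) (\<lambda>_::1. p) (\<lambda>_. a) 1) b)))
        \<in> borel_measurable (\<nu> \<Otimes>\<^sub>M \<nu>)"
      by measurable
    then show ?thesis by (simp add: loss_def slice_rule_def r' case_prod_beta)
  qed
  have risk_eq: "?risk b p = (\<integral>\<^sup>+a. ?l p b a \<partial>\<nu>)" for b p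
    by (rule risk_1[OF \<nu> slice_rule[OF r]])
  have [measurable]: "(\<lambda>b. ?risk b p) \<in> borel_measurable \<nu>" for p
    unfolding risk_eq using borel_measurable_nn_integral_fst[OF l_meas[of p]] by simp
  have slice: "(\<integral>\<^sup>+b. ?risk b p \<partial>\<nu>) \<le> risk \<mu> \<nu> c r (combine i p False)" for p
  proof -
    \<comment> \<open>The sliced rule keeps the stopping time and verdict \<open>i\<close>; its loss
      only omits the error of channel \<open>j\<close>.\<close>
    have "loss c (slice_rule i b r) (\<lambda>_. p) (drift (vec (\<mu> $ i)) (\<lambda>_. p) (\<lambda>_. a))
      \<le> loss c r (combine i p False) (drift \<mu> (combine i p False) (combine i a b))" for a b
      by (subst drift_inactive[OF ij])
         (simp_all add: loss_def slice_rule_def sum_2_pair[OF ij] combine_apply combine_apply(2)[OF ij])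
    then have "(\<integral>\<^sup>+b. ?risk b p \<partial>\<nu>) \<le> (\<integral>\<^sup>+b. \<integral>\<^sup>+a. ennreal (loss c r (combine i p False) (drift \<mu> (combine i p False) (combine i a b))) \<partial>\<nu> \<partial>\<nu>)"
      unfolding risk_eq by (intro nn_integral_mono ennreal_leI)
    also have "\<dots> = risk \<mu> \<nu> c r (combine i p False)"
      unfolding risk_def
      by (rule nn_integral_noise_2[OF \<nu>, symmetric])
         (intro measurable_compose[OF _ measurable_ennreal] loss_drift_measurable r)
    finally show ?thesis .
  qed
  \<comment> \<open>The bound \<open>v\<close> holds for every frozen path \<open>b\<close>, hence
    also on average over \<open>b\<close>.\<close>
  have "v = (\<integral>\<^sup>+b. v \<partial>\<nu>)" by (simp add: emeasure_space_1)
  also have "\<dots> \<le> (\<integral>\<^sup>+b. bayes_risk (vec (\<mu> $ i)) \<nu> c (slice_rule i b r) (vec (\<pi> $ i)) \<partial>\<nu>)"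
    by (intro nn_integral_mono v slice_rule r)
  also have "\<dots> = ennreal (\<pi> $ i) * (\<integral>\<^sup>+b. ?risk b True \<partial>\<nu>) + ennreal (1 - \<pi> $ i) * (\<integral>\<^sup>+b. ?risk b False \<partial>\<nu>)"
    unfolding bayes_risk_1 by (simp add: nn_integral_add nn_integral_cmult)
  also have "\<dots> \<le> ennreal (\<pi> $ i) * risk \<mu> \<nu> c r (combine i True False) +
      ennreal (1 - \<pi> $ i) * risk \<mu> \<nu> c r (combine i False False)"
    by (intro add_mono mult_left_mono slice) auto
  also have "\<dots> = bayes_risk \<mu> \<nu> c r \<pi>"
    unfolding bayes_risk_2[OF ij] using \<open>\<pi> $ j = 0\<close> by simp
  finally show ?thesis .
qed

section \<open>The boundary function\<close>

text \<open>Plane geometry of a family of functions affine in each variable, which stand for the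
  Bayes risks of rules; \<open>p + q\<close> is the cost of stopping at once. A difference affine
  along a segment and nonnegative at both ends is nonnegative between them. This plays the part of
  concavity, with the edges of the square supplying one of the ends.\<close>

lemma boundary_function_exists:
  fixes F :: "'r \<Rightarrow> real \<Rightarrow> real \<Rightarrow> real" and A1 A2 :: real
  assumes affine1: "\<And>r q. \<exists>a b. \<forall>p. F r p q = a + b * p"
    and affine2: "\<And>r p. \<exists>a b. \<forall>q. F r p q = a + b * q"
    and A: "0 < A1" "A1 < 1/2" "0 < A2" "A2 < 1/2"
    and cont1: "\<And>p q. A1 < p \<Longrightarrow> p \<le> 1/2 \<Longrightarrow> 0 \<le> q \<Longrightarrow> q \<le> 1/2 \<Longrightarrow> \<exists>r\<in>S. F r p q < p + q"
    and cont2: "\<And>p q. A2 < q \<Longrightarrow> q \<le> 1/2 \<Longrightarrow> 0 \<le> p \<Longrightarrow> p \<le> 1/2 \<Longrightarrow> \<exists>r\<in>S. F r p q < p + q"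
    and stop1: "\<And>p r. r \<in> S \<Longrightarrow> 0 \<le> p \<Longrightarrow> p \<le> A1 \<Longrightarrow> p \<le> F r p 0"
    and stop2: "\<And>q r. r \<in> S \<Longrightarrow> 0 \<le> q \<Longrightarrow> q \<le> A2 \<Longrightarrow> q \<le> F r 0 q"
  shows "\<exists>b. b \<in> {0..A1} \<rightarrow> {0..A2} \<and> antimono_on {0..A1} b \<and> upper_semicontinuous_on {0..A1} b \<and>
    (\<forall>p\<in>{0..1/2}. \<forall>q\<in>{0..1/2}. (\<forall>r\<in>S. p + q \<le> F r p q) \<longleftrightarrow> p \<le> A1 \<and> q \<le> b p)"
proof -
  define D where "D p q \<longleftrightarrow> p \<in> {0..1/2} \<and> q \<in> {0..1/2} \<and> (\<forall>r\<in>S. p + q \<le> F r p q)" for p q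
  have cont_F1: "continuous_on UNIV (\<lambda>p. F r p q)" for r q
  proof -
    obtain a b where "\<And>p. F r p q = a + b * p" using affine1[of r q] by blast
    then show ?thesis by (simp add: continuous_intros)
  qed
  have cont_F2: "continuous_on UNIV (\<lambda>q. F r p q)" for r p
  proof -
    obtain a b where "\<And>q. F r p q = a + b * q" using affine2[of r p] by blast
    then show ?thesis by (simp add: continuous_intros)
  qed
  have DA: "p \<le> A1" "q \<le> A2" if "D p q" for p q
    using that cont1[of p q] cont2[of q p] unfolding D_def by force+
  have affine_nonneg: "0 \<le> a + b * x" if "0 \<le> a" "0 \<le> a + b * y" "0 \<le> x" "x \<le> y" for a b x y :: real
  proof (cases "0 \<le> b")
    case False
    then have "b * y \<le> b * x" using that by (intro mult_left_mono_neg) auto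
    with that show ?thesis by linarith
  qed (use that in simp)
  \<comment> \<open>By \<open>cont2\<close> the ordinate is at most \<open>A2\<close>, so
    \<open>stop2\<close> makes the foot \<open>(0, q)\<close> a stopping point;
    \<open>(p', q)\<close> lies between it and \<open>(p, q)\<close>.\<close>
  have down1: "D p' q" if D: "D p q" and p': "0 \<le> p'" "p' \<le> p" for p p' q
  proof -
    have "p' + q \<le> F r p' q" if r: "r \<in> S" for r
    proof -
      obtain a b where F: "\<And>p. F r p q = a + b * p" using affine1[of r q] by blast
      have "q \<le> a" using stop2[OF r, of q] D DA(2)[OF D] F[of 0] by (simp add: D_def)
      moreover have "p + q \<le> F r p q" using D r by (simp add: D_def)
      ultimately have "0 \<le> a - q" "0 \<le> (a - q) + (b - 1) * p" by (simp_all add: F left_diff_distrib)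
      from affine_nonneg[OF this p'] have "0 \<le> (a - q) + (b - 1) * p'" .
      then show ?thesis by (simp add: F algebra_simps)
    qed
    with D p' show ?thesis by (auto simp: D_def)
  qed
  have down2: "D p q'" if D: "D p q" and q': "0 \<le> q'" "q' \<le> q" for p q q'
  proof -
    have "p + q' \<le> F r p q'" if r: "r \<in> S" for r
    proof -
      obtain a b where F: "\<And>q. F r p q = a + b * q" using affine2[of r p] by blast
      have "p \<le> a" using stop1[OF r, of p] D DA(1)[OF D] F[of 0] by (simp add: D_def)
      moreover have "p + q \<le> F r p q" using D r by (simp add: D_def)
      ultimately have "0 \<le> a - p" "0 \<le> (a - p) + (b - 1) * q" by (simp_all add: F left_diff_distrib)
      from affine_nonneg[OF this q'] have "0 \<le> (a - p) + (b - 1) * q'" .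
      then show ?thesis by (simp add: F algebra_simps)
    qed
    with D q' show ?thesis by (auto simp: D_def)
  qed
  define b where "b p = Sup {q. D p q}" for p
  have D0: "D p 0" if "p \<in> {0..A1}" for p
    using that A stop1[of _ p] by (auto simp: D_def)
  have bdd: "bdd_above {q. D p q}" for p
    using DA(2) by (intro bdd_aboveI[of _ A2]) auto
  have b_upper: "q \<le> b p" if "D p q" for p q
    unfolding b_def using that bdd by (intro cSup_upper) auto
  \<comment> \<open>A vertical section is closed and contains 0, so its supremum is attained.
    Properties of \<open>b\<close> can then be read off a point of \<open>D\<close>.\<close>
  have Db: "D p (b p)" if p: "p \<in> {0..A1}" for p
  proof -
    have "{q. D p q} = (if p \<in> {0..1/2} then {0..1/2} \<inter> (\<Inter>r\<in>S. {q. p + q \<le> F r p q}) else {})"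
      by (auto simp: D_def)
    moreover have "closed {q. p + q \<le> F r p q}" for r
      by (intro closed_Collect_le continuous_intros cont_F2)
    ultimately have "closed {q. D p q}" by (auto intro!: closed_INT)
    then have "b p \<in> {q. D p q}"
      unfolding b_def using D0[OF p] by (intro closed_contains_Sup bdd) auto
    then show ?thesis by simp
  qed
  have b_range: "b p \<in> {0..A2}" if "p \<in> {0..A1}" for p
    using Db[OF that] DA(2)[of p "b p"] by (auto simp: D_def)
  have "antimono_on {0..A1} b"
  proof (rule monotone_onI)
    fix p p' assume p: "p \<in> {0..A1}" "p' \<in> {0..A1}" "p \<le> p'"
    then show "b p' \<le> b p" using down1[OF Db[OF p(2)], of p] by (intro b_upper) auto
  qed
  moreover have "upper_semicontinuous_on {0..A1} b"
    unfolding upper_semicontinuous_on_def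
  proof (intro ballI allI impI)
    fix x a assume x: "x \<in> {0..A1}" and a: "b x < a"
    have ev: "\<forall>\<^sub>F y in at x within {0..A1}. y \<in> {0..A1}"
      by (simp add: eventually_at_filter)
    show "\<forall>\<^sub>F y in at x within {0..A1}. b y < a"
    \<comment> \<open>A level above 1/2 lies outside the range of \<open>D\<close>, so failure of
      \<open>D\<close> would provide no rule; there \<open>b \<le> A2 < 1/2\<close> settles the
      claim.\<close>
    proof (cases "a \<le> 1/2")
      case False
      from ev show ?thesis
      proof eventually_elim
        case (elim y)
        with b_range[OF elim] A False show ?case by auto
      qed
    next
      case True
      have "0 \<le> a" using a b_range[OF x] by auto
      moreover have "\<not> D x a" using b_upper[of x a] a by auto
      \<comment> \<open>One rule beats stopping at \<open>(x, a)\<close> and, by continuity in the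
        first variable, still does so at \<open>(y, a)\<close> for nearby \<open>y\<close>. With
        \<open>a \<le> b y\<close>, downward closedness would put \<open>(y, a)\<close> in
        \<open>D\<close>.\<close>
      ultimately obtain r where r: "r \<in> S" "F r x a < x + a" using x A True by (auto simp: D_def not_le)
      have "continuous_on UNIV (\<lambda>y. F r y a - (y + a))" by (intro continuous_intros cont_F1)
      then have "((\<lambda>y. F r y a - (y + a)) \<longlongrightarrow> F r x a - (x + a)) (at x within {0..A1})"
        by (meson continuous_on_def UNIV_I subset_UNIV tendsto_within_subset)
      then have "\<forall>\<^sub>F y in at x within {0..A1}. F r y a - (y + a) < 0"
        using r(2) by (intro order_tendstoD) auto
      with ev show ?thesis
      proof eventually_elim
        case (elim y)
        show "b y < a"
        proof (rule ccontr)
          assume "\<not> b y < a"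
          then have "D y a" using down2[OF Db[OF elim(1)], of a] \<open>0 \<le> a\<close> by auto
          with r elim show False by (force simp: D_def)
        qed
      qed
    qed
  qed
  moreover have "(\<forall>r\<in>S. p + q \<le> F r p q) \<longleftrightarrow> p \<le> A1 \<and> q \<le> b p" if "p \<in> {0..1/2}" "q \<in> {0..1/2}" for p q
  proof
    assume "\<forall>r\<in>S. p + q \<le> F r p q"
    then have "D p q" using that by (simp add: D_def)
    then show "p \<le> A1 \<and> q \<le> b p" using DA b_upper by blast
  next
    assume "p \<le> A1 \<and> q \<le> b p"
    then have "D p q" using that down2[OF Db, of p q] by auto
    then show "\<forall>r\<in>S. p + q \<le> F r p q" by (simp add: D_def)
  qed
  ultimately show ?thesis using b_range by blast
qed

section \<open>From rules back to continuation and stopping regions\<close>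

lemma sequential_testing_lawI:
  assumes model: "sequential_testing_model \<mu> M P Y W Post"
    and N: "prob_space N" "standard_brownian_motion N B"
  shows "sequential_testing_law \<mu> M P Y W Post (distr N path_space (\<lambda>\<omega> s. B s \<omega>))"
proof -
  interpret sequential_testing_model \<mu> M P Y W Post by (rule model)
  show ?thesis
    by unfold_locales (intro brownian_path_law_unique prob_space_P W_brownian N; assumption)
qed

context sequential_testing_law
begin

text \<open>The strict form is the useful one: an infimum below \<open>b\<close> yields a rule below
  \<open>b\<close>, even if the infimum itself is not attained.\<close>

lemma V_less_iff:
  assumes "\<pi> \<in> cbox 0 1" "0 \<le> c"
  shows "V c \<pi> < b \<longleftrightarrow> (\<exists>r\<in>decision_rules. bayes_risk \<mu> \<nu> c r \<pi> < b)"
proof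
  assume "\<exists>r\<in>decision_rules. bayes_risk \<mu> \<nu> c r \<pi> < b"
  then show "V c \<pi> < b" using V_le_bayes_risk[OF assms(1) _ assms(2)] by (meson le_less_trans)
next
  assume *: "V c \<pi> < b"
  show "\<exists>r\<in>decision_rules. bayes_risk \<mu> \<nu> c r \<pi> < b"
  proof (rule ccontr)
    assume "\<not> (\<exists>r\<in>decision_rules. bayes_risk \<mu> \<nu> c r \<pi> < b)"
    then have "b \<le> V c \<pi>" by (intro le_V_if_le_bayes_risk assms) (auto simp: not_less)
    with * show False by simp
  qed
qed

end

text \<open>Up to 1/2 the cost of stopping is \<open>p\<close> itself and the right end of the
  continuation interval is out of reach, so only the comparison with \<open>A\<close>
  remains.\<close>

lemma continuation_region_1_iff:
  fixes m :: real
  assumes law: "sequential_testing_law (vec m :: real ^ 1) M P Y W Post \<nu>" and c: "0 \<le> c"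
    and region: "sequential_testing.continuation_region (vec m :: real ^ 1) M P Y W Post c = vec ` {A<..<1 - A}"
    and p: "p \<in> {0..1/2}" and A: "A < 1/2"
  shows "(\<exists>r\<in>decision_rules. bayes_risk (vec m :: real ^ 1) \<nu> c r (vec p) < ennreal p) \<longleftrightarrow> A < p"
proof -
  interpret sequential_testing_law "vec m :: real ^ 1" M P Y W Post \<nu> by (rule law)
  have box: "(vec p :: real ^ 1) \<in> cbox 0 1" using p by (simp add: mem_box_cart)
  have "g (vec p) = p" using p by (simp add: g_def)
  then have "(\<exists>r\<in>decision_rules. bayes_risk (vec m :: real ^ 1) \<nu> c r (vec p) < ennreal p)
      \<longleftrightarrow> (vec p :: real ^ 1) \<in> continuation_region c"
    using V_less_iff[OF box c, of "ennreal p"] box by (simp add: continuation_region_def)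
  also have "\<dots> \<longleftrightarrow> p \<in> {A<..<1 - A}"
    unfolding region by (auto simp: vec_eq_iff image_iff)
  also have "\<dots> \<longleftrightarrow> A < p" using p A by auto
  finally show ?thesis .
qed

lemma stop_now_rule: "(\<lambda>_. 0, \<lambda>_ _. False) \<in> decision_rules"
  using sets.top[of "canonical_filtration t" for t] by (auto simp: decision_rules_def)

text \<open>With both coordinates at most 1/2, stopping at once and declaring both hypotheses false
  costs exactly \<open>g\<close>. Hence \<open>V \<le> g\<close>, and stopping is the negation of
  \<open>V < g\<close>.\<close>

lemma stopping_region_iff:
  fixes \<mu> :: "real ^ 2"
  assumes law: "sequential_testing_law \<mu> M P Y W Post \<nu>" and c: "0 \<le> c"
    and \<pi>: "\<pi> $ 1 \<in> {0..1/2}" "\<pi> $ 2 \<in> {0..1/2}"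
  shows "\<pi> \<in> sequential_testing.stopping_region \<mu> M P Y W Post c \<longleftrightarrow>
    (\<forall>r\<in>decision_rules. ennreal (\<pi> $ 1 + \<pi> $ 2) \<le> bayes_risk \<mu> \<nu> c r \<pi>)"
proof -
  interpret sequential_testing_law \<mu> M P Y W Post \<nu> by (rule law)
  have box: "\<pi> \<in> cbox 0 1" using \<pi> by (auto simp: mem_box_cart forall_2)
  interpret N: prob_space \<nu> by (rule prob_space_law)
  let ?r = "(\<lambda>_. 0, \<lambda>_ _. False) :: ((1 \<Rightarrow> real \<Rightarrow> real) \<Rightarrow> real) \<times> ((1 \<Rightarrow> real \<Rightarrow> real) \<Rightarrow> 1 \<Rightarrow> bool)"
  have 12: "(1 :: 2) \<noteq> 2" by simp
  have risk: "risk (vec (\<mu> $ 1)) \<nu> c ?r (\<lambda>_. y) = ennreal (of_bool y)" for y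
    by (simp add: risk_1[OF prob_space_law sets_law stop_now_rule] loss_def N.emeasure_space_1)
  have "bayes_risk \<mu> \<nu> c (lift_rule 1 ?r) \<pi> = ennreal (\<pi> $ 1 + \<pi> $ 2)"
    unfolding bayes_risk_lift_rule[OF prob_space_law sets_law stop_now_rule 12 c box] bayes_risk_1 risk
    using \<pi> by (simp add: ennreal_plus)
  then have le: "V c \<pi> \<le> ennreal (\<pi> $ 1 + \<pi> $ 2)"
    using V_le_bayes_risk[OF box lift_rule[OF stop_now_rule] c] by metis
  have g: "g \<pi> = \<pi> $ 1 + \<pi> $ 2" using \<pi> by (simp add: g_def UNIV_2)
  have "\<pi> \<in> stopping_region c \<longleftrightarrow> \<not> V c \<pi> < ennreal (\<pi> $ 1 + \<pi> $ 2)"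
    using le box by (auto simp: stopping_region_def g)
  then show ?thesis unfolding V_less_iff[OF box c] by (auto simp: not_less)
qed

theorem proposition4p2:
  fixes \<mu> :: "real ^ 2" and c A1 A2 :: real
    and M :: "'w measure" and P :: "real ^ 2 \<Rightarrow> 'w measure"
    and Y :: "2 \<Rightarrow> 'w \<Rightarrow> real" and W :: "2 \<Rightarrow> real \<Rightarrow> 'w \<Rightarrow> real"
    and Post :: "real ^ 2 \<Rightarrow> real \<Rightarrow> 'w \<Rightarrow> real ^ 2"
    and M1 :: "'u measure" and P1 :: "real ^ 1 \<Rightarrow> 'u measure"
    and Y1 :: "1 \<Rightarrow> 'u \<Rightarrow> real" and W1 :: "1 \<Rightarrow> real \<Rightarrow> 'u \<Rightarrow> real"
    and Post1 :: "real ^ 1 \<Rightarrow> real \<Rightarrow> 'u \<Rightarrow> real ^ 1"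
    and M2 :: "'v measure" and P2 :: "real ^ 1 \<Rightarrow> 'v measure"
    and Y2 :: "1 \<Rightarrow> 'v \<Rightarrow> real" and W2 :: "1 \<Rightarrow> real \<Rightarrow> 'v \<Rightarrow> real"
    and Post2 :: "real ^ 1 \<Rightarrow> real \<Rightarrow> 'v \<Rightarrow> real ^ 1"
    and R1 :: "(real ^ 2) set"
  defines "R1 \<equiv> {\<pi>. \<pi> $ 1 \<in> {0..1/2} \<and> \<pi> $ 2 \<in> {0..1/2}}"
  assumes "0 < \<mu> $ 1" and "0 < \<mu> $ 2" and "0 < c"
    and model: "sequential_testing_model \<mu> M P Y W Post"
    and model1: "sequential_testing_model (vec (\<mu> $ 1)) M1 P1 Y1 W1 Post1"
    and model2: "sequential_testing_model (vec (\<mu> $ 2)) M2 P2 Y2 W2 Post2"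
    and "0 < A1" and "A1 < 1/2"
    and "sequential_testing.continuation_region (vec (\<mu> $ 1)) M1 P1 Y1 W1 Post1 c
           = vec ` {A1<..<1 - A1}"
    and "0 < A2" and "A2 < 1/2"
    and "sequential_testing.continuation_region (vec (\<mu> $ 2)) M2 P2 Y2 W2 Post2 c
           = vec ` {A2<..<1 - A2}"
  shows "\<exists>b :: real \<Rightarrow> real.
      b \<in> {0..A1} \<rightarrow> {0..A2} \<and>
      antimono_on {0..A1} b \<and>
      upper_semicontinuous_on {0..A1} b \<and>
      sequential_testing.stopping_region \<mu> M P Y W Post c \<inter> R1
        = {\<pi> \<in> R1. \<pi> $ 1 \<le> A1 \<and> \<pi> $ 2 \<le> b (\<pi> $ 1)}"
proof -
  have box0: "(0 :: real ^ 2) \<in> cbox 0 1" by (simp add: mem_box_cart)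
  note N = sequential_testing_model.prob_space_P[OF model box0]
    sequential_testing_model.W_brownian[OF model box0, of 1]
  \<comment> \<open>Channel 1 at prior 0 is an arbitrary representative: by uniqueness of the
    Brownian path law, \<open>\<nu>\<close> is the noise law of every channel under every prior in
    all three models.\<close>
  define \<nu> where "\<nu> = distr (P 0) path_space (\<lambda>\<omega> s. W 1 s \<omega>)"
  note law = sequential_testing_lawI[OF model N, folded \<nu>_def]
  note law1 = sequential_testing_lawI[OF model1 N, folded \<nu>_def]
  note law2 = sequential_testing_lawI[OF model2 N, folded \<nu>_def]
  have \<nu>: "prob_space \<nu>" "sets \<nu> = sets path_space"
    using sequential_testing_law.prob_space_law[OF law] sequential_testing_law.sets_law[OF law] by auto
  have c: "0 \<le> c" using \<open>0 < c\<close> by simp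
  note iff1 = continuation_region_1_iff[OF law1 c assms(10) _ assms(9)]
  note iff2 = continuation_region_1_iff[OF law2 c assms(13) _ assms(12)]
  define \<rho> where "\<rho> r u v = enn2real (risk \<mu> \<nu> c r (combine 1 u v))" for r u v
  \<comment> \<open>The real polynomial behind the Bayes risk, taken on the whole plane so that
    affine dependence holds without side conditions; the two agree on the unit square.\<close>
  define F where "F r p q = p * q * \<rho> r True True + p * (1 - q) * \<rho> r True False +
    (1 - p) * q * \<rho> r False True + (1 - p) * (1 - q) * \<rho> r False False" for r p q
  define S where "S = (decision_rules :: (((2 \<Rightarrow> real \<Rightarrow> real) \<Rightarrow> real) \<times> ((2 \<Rightarrow> real \<Rightarrow> real) \<Rightarrow> 2 \<Rightarrow> bool)) set)"
  have bayes: "bayes_risk \<mu> \<nu> c r \<pi> = ennreal (F r (\<pi> $ 1) (\<pi> $ 2))" "0 \<le> F r (\<pi> $ 1) (\<pi> $ 2)"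
    if "r \<in> S" "\<pi> \<in> cbox 0 1" for r \<pi>
  proof -
    have 01: "0 \<le> \<pi> $ k" "\<pi> $ k \<le> 1" for k using that(2) by (auto simp: mem_box_cart)
    have \<rho>0: "0 \<le> \<rho> r u v" for u v by (simp add: \<rho>_def)
    have \<rho>: "risk \<mu> \<nu> c r (combine 1 u v) = ennreal (\<rho> r u v)" for u v
      using risk_finite[OF that(1)[unfolded S_def] c \<nu>(1)] by (simp add: \<rho>_def)
    have 12: "(1 :: 2) \<noteq> 2" by simp
    show "0 \<le> F r (\<pi> $ 1) (\<pi> $ 2)" unfolding F_def using 01 \<rho>0 by simp
    show "bayes_risk \<mu> \<nu> c r \<pi> = ennreal (F r (\<pi> $ 1) (\<pi> $ 2))"
      unfolding bayes_risk_2[OF 12] \<rho> F_def using 01 \<rho>0 by (simp add: ennreal_mult ennreal_plus)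
  qed
  define pt where "pt p q = ((\<chi> k. if k = 1 then p else q) :: real ^ 2)" for p q
  have pt: "pt p q $ 1 = p" "pt p q $ 2 = q" for p q by (simp_all add: pt_def)
  have pt_box: "pt p q \<in> cbox 0 1" if "p \<in> {0..1}" "q \<in> {0..1}" for p q
    using that by (simp add: mem_box_cart pt_def)
  have "\<exists>b. b \<in> {0..A1} \<rightarrow> {0..A2} \<and> antimono_on {0..A1} b \<and> upper_semicontinuous_on {0..A1} b \<and>
    (\<forall>p\<in>{0..1/2}. \<forall>q\<in>{0..1/2}. (\<forall>r\<in>S. p + q \<le> F r p q) \<longleftrightarrow> p \<le> A1 \<and> q \<le> b p)"
  proof (rule boundary_function_exists)
    fix r p q
    have "\<forall>p. F r p q = q * \<rho> r False True + (1 - q) * \<rho> r False False +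
       (q * \<rho> r True True + (1 - q) * \<rho> r True False - (q * \<rho> r False True + (1 - q) * \<rho> r False False)) * p"
      by (simp add: F_def algebra_simps)
    then show "\<exists>a b. \<forall>p. F r p q = a + b * p" by blast
    have "\<forall>q. F r p q = p * \<rho> r True False + (1 - p) * \<rho> r False False +
       (p * \<rho> r True True + (1 - p) * \<rho> r False True - (p * \<rho> r True False + (1 - p) * \<rho> r False False)) * q"
      by (simp add: F_def algebra_simps)
    then show "\<exists>a b. \<forall>q. F r p q = a + b * q" by blast
  next
    \<comment> \<open>Lifting adds exactly the prior of the other channel to the one-dimensional
      risk, so beating one coordinate in its own problem means beating \<open>p + q\<close> in the
      plane.\<close>
    have lift: "\<exists>r\<in>S. F r p q < p + q"
      if pq: "p \<in> {0..1/2}" "q \<in> {0..1/2}" and ij: "(i :: 2) \<noteq> j"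
        and r: "r \<in> decision_rules" "bayes_risk (vec (\<mu> $ i) :: real ^ 1) \<nu> c r (vec (pt p q $ i)) < ennreal (pt p q $ i)"
      for p q i j r
    proof -
      have box: "pt p q \<in> cbox 0 1" using pq by (intro pt_box) auto
      have 0: "0 \<le> pt p q $ k" for k using pq by (simp add: pt_def)
      have S: "lift_rule i r \<in> S" unfolding S_def by (rule lift_rule[OF r(1)])
      have "ennreal (F (lift_rule i r) p q) = bayes_risk (vec (\<mu> $ i) :: real ^ 1) \<nu> c r (vec (pt p q $ i)) + ennreal (pt p q $ j)"
        using bayes(1)[OF S box] bayes_risk_lift_rule[OF \<nu> r(1) ij c box, of \<mu>] by (simp add: pt)
      also have "\<dots> < ennreal (pt p q $ i) + ennreal (pt p q $ j)"
        using r(2) by (simp add: ennreal_add_left_cancel_less add.commute)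
      also have "\<dots> = ennreal (pt p q $ i + pt p q $ j)" using 0 by simp
      also have "pt p q $ i + pt p q $ j = p + q"
        using sum_2_pair[OF ij, of "\<lambda>k. pt p q $ k"] by (simp add: UNIV_2 pt)
      finally have "F (lift_rule i r) p q < p + q"
        using bayes(2)[OF S box] by (simp add: ennreal_less_iff pt)
      then show ?thesis using S by blast
    qed
    show "\<exists>r\<in>S. F r p q < p + q" if "A1 < p" "p \<le> 1/2" "0 \<le> q" "q \<le> 1/2" for p q
      using that iff1[of p] \<open>0 < A1\<close> lift[of p q 1 2] by (auto simp: pt)
    show "\<exists>r\<in>S. F r p q < p + q" if "A2 < q" "q \<le> 1/2" "0 \<le> p" "p \<le> 1/2" for p q
      using that iff2[of q] \<open>0 < A2\<close> lift[of p q 2 1] by (auto simp: pt)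
  next
    \<comment> \<open>At an edge point the prior of channel \<open>j\<close> vanishes. If no
      one-dimensional rule beats the remaining coordinate there, freezing the pure noise shows that
      no plane rule does.\<close>
    have slice: "ennreal (pt p q $ i) \<le> ennreal (F r p q)"
      if r: "r \<in> S" and pq: "p \<in> {0..1/2}" "q \<in> {0..1/2}" and ij: "(i :: 2) \<noteq> j" "pt p q $ j = 0"
        and *: "\<not> (\<exists>r\<in>decision_rules. bayes_risk (vec (\<mu> $ i) :: real ^ 1) \<nu> c r (vec (pt p q $ i)) < ennreal (pt p q $ i))"
      for p q i j r
    proof -
      have box: "pt p q \<in> cbox 0 1" using pq by (intro pt_box) auto
      have "ennreal (pt p q $ i) \<le> bayes_risk \<mu> \<nu> c r (pt p q)"
        using * by (intro le_bayes_risk_if_inactive[OF \<nu> r[unfolded S_def] ij(1) c box ij(2)]) (auto simp: not_less)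
      then show ?thesis using bayes(1)[OF r box] by (simp add: pt)
    qed
    show "p \<le> F r p 0" if "r \<in> S" "0 \<le> p" "p \<le> A1" for p r
    proof -
      have "p \<in> {0..1/2}" using that \<open>A1 < 1/2\<close> by auto
      then have "ennreal p \<le> ennreal (F r p 0)"
        using slice[OF that(1), of p 0 1 2] iff1[of p] that by (simp add: pt)
      moreover have "0 \<le> F r p 0"
        using bayes(2)[OF that(1) pt_box, of p 0] \<open>p \<in> {0..1/2}\<close> by (simp add: pt)
      ultimately show ?thesis by (simp add: ennreal_le_iff)
    qed
    show "q \<le> F r 0 q" if "r \<in> S" "0 \<le> q" "q \<le> A2" for q r
    proof -
      have "q \<in> {0..1/2}" using that \<open>A2 < 1/2\<close> by auto
      then have "ennreal q \<le> ennreal (F r 0 q)"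
        using slice[OF that(1), of 0 q 2 1] iff2[of q] that by (simp add: pt)
      moreover have "0 \<le> F r 0 q"
        using bayes(2)[OF that(1) pt_box, of 0 q] \<open>q \<in> {0..1/2}\<close> by (simp add: pt)
      ultimately show ?thesis by (simp add: ennreal_le_iff)
    qed
  qed (use assms in auto)
  then obtain b where b: "b \<in> {0..A1} \<rightarrow> {0..A2}" "antimono_on {0..A1} b" "upper_semicontinuous_on {0..A1} b"
    and iff: "\<And>p q. p \<in> {0..1/2} \<Longrightarrow> q \<in> {0..1/2} \<Longrightarrow> (\<forall>r\<in>S. p + q \<le> F r p q) \<longleftrightarrow> p \<le> A1 \<and> q \<le> b p"
    by blast
  have "\<pi> \<in> sequential_testing.stopping_region \<mu> M P Y W Post c \<longleftrightarrow> \<pi> $ 1 \<le> A1 \<and> \<pi> $ 2 \<le> b (\<pi> $ 1)"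
    if "\<pi> \<in> R1" for \<pi>
  proof -
    have \<pi>: "\<pi> $ 1 \<in> {0..1/2}" "\<pi> $ 2 \<in> {0..1/2}" using that by (auto simp: R1_def)
    then have box: "\<pi> \<in> cbox 0 1" by (auto simp: mem_box_cart forall_2)
    have "\<pi> \<in> sequential_testing.stopping_region \<mu> M P Y W Post c \<longleftrightarrow>
        (\<forall>r\<in>S. ennreal (\<pi> $ 1 + \<pi> $ 2) \<le> ennreal (F r (\<pi> $ 1) (\<pi> $ 2)))"
      unfolding stopping_region_iff[OF law c \<pi>] S_def[symmetric] using bayes(1)[OF _ box] by simp
    also have "\<dots> \<longleftrightarrow> (\<forall>r\<in>S. \<pi> $ 1 + \<pi> $ 2 \<le> F r (\<pi> $ 1) (\<pi> $ 2))"
      using bayes(2)[OF _ box] by (simp add: ennreal_le_iff)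
    finally show ?thesis unfolding iff[OF \<pi>] .
  qed
  then have "sequential_testing.stopping_region \<mu> M P Y W Post c \<inter> R1
        = {\<pi> \<in> R1. \<pi> $ 1 \<le> A1 \<and> \<pi> $ 2 \<le> b (\<pi> $ 1)}" by blast
  with b show ?thesis by blast
qed

end
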